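(* Let $n\ge 1$, $\ell\ge 0$ and let $\boldsymbol\lambda:\mathscr C_n\to\mathbb S_\ell$ be a Fomin field of interlacing signatures of length $\ell$ on the cylindrical lattice $\mathscr C_n$. Then there exist an integer partition $\mu=(\mu_1\ge\dots\ge\mu_{\ell'}>0)$ with $\ell'\le\ell$ and a time $t^*>0$ such that for all integers $t\ge t^*$ and all $i\in\{0,\dots,n\}$ $$\boldsymbol\lambda(t+n,i)=\boldsymbol\lambda(t,i)+(\mu_1,\dots,\mu_{\ell'},0,\dots,0),\qquad \boldsymbol\lambda(-t-n,i)=\boldsymbol\lambda(-t,i)-(0,\dots,0,\mu_{\ell'},\dots,\mu_1),$$ where the added vectors have $\ell$ entries and addition is entrywise.
   Context: Signatures. A signature of length $\ell\ge 0$ is a sequence of integers $\lambda=(\lambda_1\ge\dots\ge\lambda_\ell)$; $\mathbb S_\ell$ is the set of these. The conjugate of $\lambda$ is the sequence $\lambda'=(\lambda'_x)_{x\in\mathbb Z}$, $\lambda'_x=\#\{j:\lambda_j\ge x\}$; it determines $\lambda$. For $\kappa,\mu\in\mathbb S_\ell$ write $\kappa\preceq\mu$ if $\mu_1\ge\kappa_1\ge\mu_2\ge\kappa_2\ge\dots\ge\mu_\ell\ge\kappa_\ell$ (equivalently $\mu'_x-\kappa'_x\in\{0,1\}$ for all $x$). Fomin growth operator. Let $\kappa,\mu,\lambda\in\mathbb S_\ell$ with $\kappa\preceq\mu$ and $\kappa\preceq\lambda$. Put $a_x=\mu'_x-\kappa'_x$, $b_x=\lambda'_x-\kappa'_x$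 (finitely supported, in $\{0,1\}$) and define $(c_x)_{x\in\mathbb Z}$ by $c_x=\max\{0,a_x+b_x+c_{x-1}-1\}$ with $c_x=0$ for $x$ sufficiently negative. Then $\overline{\mathsf F}(\kappa,\mu,\lambda)=\nu$ is the signature in $\mathbb S_\ell$ with $\nu'_x=\mu'_x+\lambda'_x-\kappa'_x+c_{x-1}-c_x$ for all $x\in\mathbb Z$ (it satisfies $\mu\preceq\nu$, $\lambda\preceq\nu$). Cylinder and Fomin fields. $\mathscr C_n=\mathbb Z^2/\sim$ where $(x,y)\sim(x+kn,y-kn)$ for $k\in\mathbb Z$; $\mathbf e_1=(1,0)$, $\mathbf e_2=(0,1)$. A Fomin field of length $\ell$ is a map $\boldsymbol\lambda:\mathscr C_n\to\mathbb S_\ell$ with $\boldsymbol\lambda(p)\preceq\boldsymbol\lambda(p+\mathbf e_i)$ for $i=1,2$ and $\boldsymbol\lambda(p+\mathbf e_1+\mathbf e_2)=\overline{\mathsf F}(\boldsymbol\lambda(p),\boldsymbol\lambda(p+\mathbf e_1),\boldsymbol\lambda(p+\mathbf e_2))$ for all $p\in\mathscr C_n$. *)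

theory Defs
  imports Main "HOL-Library.Product_Plus"
begin

definition signatures :: "nat \<Rightarrow> int list set" where
  "signatures l = {xs. length xs = l \<and> sorted_wrt (\<ge>) xs}"

definition conjugate :: "int list \<Rightarrow> int \<Rightarrow> int" where
  "conjugate xs x = int (card {j. j < length xs \<and> xs ! j \<ge> x})"

definition interlaces :: "int list \<Rightarrow> int list \<Rightarrow> bool" (infix \<open>\<preceq>\<close> 50) where
  "\<kappa> \<preceq> \<mu> \<longleftrightarrow> length \<kappa> = length \<mu>
     \<and> (\<forall>j < length \<mu>. \<mu> ! j \<ge> \<kappa> ! j)
     \<and> (\<forall>j. Suc j < length \<mu> \<longrightarrow> \<kappa> ! j \<ge> \<mu> ! Suc j)"

definition is_carry :: "(int \<Rightarrow> int) \<Rightarrow> (int \<Rightarrow> int) \<Rightarrow> (int \<Rightarrow> int) \<Rightarrow> bool" where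
  "is_carry a b c \<longleftrightarrow> (\<forall>x. c x = max 0 (a x + b x + c (x - 1) - 1))
     \<and> (\<forall>\<^sub>F x in at_bot. c x = 0)"

text \<open>The two descriptions below are meaningful by the lemmas \<open>is_carry_carry\<close> and
  \<open>fomin_growth_spec\<close> at the end of this theory.\<close>

definition carry :: "(int \<Rightarrow> int) \<Rightarrow> (int \<Rightarrow> int) \<Rightarrow> int \<Rightarrow> int" where
  "carry a b = (THE c. is_carry a b c)"

definition fomin_growth :: "int list \<Rightarrow> int list \<Rightarrow> int list \<Rightarrow> int list" where
  "fomin_growth \<kappa> \<mu> \<rho> =
     (let c = carry (\<lambda>x. conjugate \<mu> x - conjugate \<kappa> x) (\<lambda>x. conjugate \<rho> x - conjugate \<kappa> x)
      in THE \<nu>. \<nu> \<in> signatures (length \<kappa>) \<and>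
           (\<forall>x. conjugate \<nu> x =
              conjugate \<mu> x + conjugate \<rho> x - conjugate \<kappa> x + c (x - 1) - c x))"

definition cyl_rel :: "nat \<Rightarrow> ((int \<times> int) \<times> (int \<times> int)) set" where
  "cyl_rel n = {((x, y), (x', y')) | x y x' y'. \<exists>k. x' = x + k * int n \<and> y' = y - k * int n}"

definition cylinder :: "nat \<Rightarrow> (int \<times> int) set set" where
  "cylinder n = UNIV // cyl_rel n"

definition cyl_point :: "nat \<Rightarrow> int \<Rightarrow> int \<Rightarrow> (int \<times> int) set" where
  "cyl_point n x y = cyl_rel n `` {(x, y)}"

text \<open>Points of the cylinder are equivalence classes, so translating a point means
  translating every representative; see \<open>translate_cyl_point\<close>.\<close>

definition translate :: "(int \<times> int) set \<Rightarrow> int \<times> int \<Rightarrow> (int \<times> int) set" where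
  "translate p v = (\<lambda>q. q + v) ` p"

definition fomin_field :: "nat \<Rightarrow> nat \<Rightarrow> ((int \<times> int) set \<Rightarrow> int list) \<Rightarrow> bool" where
  "fomin_field n l F \<longleftrightarrow> (\<forall>p \<in> cylinder n.
       F p \<in> signatures l
     \<and> F p \<preceq> F (translate p (1, 0))
     \<and> F p \<preceq> F (translate p (0, 1))
     \<and> F (translate p (1, 1)) =
         fomin_growth (F p) (F (translate p (1, 0))) (F (translate p (0, 1))))"

text \<open>Trailing zeros are not part of a partition.\<close>

definition is_partition :: "int list \<Rightarrow> bool" where
  "is_partition m \<longleftrightarrow> sorted_wrt (\<ge>) m \<and> (\<forall>k \<in> set m. k > 0)"


subsection \<open>Well-definedness\<close>

lemma equiv_cyl_rel: "equiv UNIV (cyl_rel n)"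
proof (rule equivI)
  show "refl (cyl_rel n)"
    unfolding refl_on_def cyl_rel_def by (auto intro: exI[of _ 0])
  show "sym (cyl_rel n)"
    unfolding sym_def cyl_rel_def by (auto intro: exI[of _ "- k" for k])
  show "trans (cyl_rel n)"
  proof (rule transI)
    fix p q r assume "(p, q) \<in> cyl_rel n" "(q, r) \<in> cyl_rel n"
    then obtain x y k m where "p = (x, y)" "q = (x + k * int n, y - k * int n)"
      "r = (x + k * int n + m * int n, y - k * int n - m * int n)"
      unfolding cyl_rel_def by auto
    then have "p = (x, y)" "r = (x + (k + m) * int n, y - (k + m) * int n)"
      by (auto simp: algebra_simps)
    then show "(p, r) \<in> cyl_rel n"
      unfolding cyl_rel_def by blast
  qed
qed simp

lemma cyl_point_in_cylinder: "cyl_point n x y \<in> cylinder n"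
  unfolding cyl_point_def cylinder_def by (rule quotientI) simp

lemma cylinder_cases:
  assumes "p \<in> cylinder n"
  obtains x y where "p = cyl_point n x y"
  using assms unfolding cyl_point_def cylinder_def by (auto elim!: quotientE)

lemma cyl_point_alt:
  "cyl_point n x y = range (\<lambda>k. (x + k * int n, y - k * int n))"
  unfolding cyl_point_def cyl_rel_def by auto

lemma translate_cyl_point:
  "translate (cyl_point n x y) (u, v) = cyl_point n (x + u) (y + v)"
  unfolding translate_def cyl_point_alt image_image
  by (rule image_cong) (auto simp: algebra_simps)

lemma is_carry_unique:
  assumes "is_carry a b c" "is_carry a b d"
  shows "c = d"
proof
  fix x
  have "\<forall>\<^sub>F x in at_bot. c x = 0 \<and> d x = 0"
    by (rule eventually_conj) (use assms in \<open>unfold is_carry_def, blast+\<close>)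
  then obtain N where N: "\<And>x. x \<le> N \<Longrightarrow> c x = 0 \<and> d x = 0"
    by (auto simp: eventually_at_bot_linorder)
  show "c x = d x"
  proof (cases "x \<le> N")
    case False
    then have "N \<le> x" by simp
    then show ?thesis
    proof (induction x rule: int_ge_induct)
      case base
      show ?case using N by simp
    next
      case (step i)
      have "c (i + 1) = max 0 (a (i + 1) + b (i + 1) + c (i + 1 - 1) - 1)"
        "d (i + 1) = max 0 (a (i + 1) + b (i + 1) + d (i + 1 - 1) - 1)"
        using assms unfolding is_carry_def by blast+
      then show ?case using step by simp
    qed
  qed (use N in simp)
qed

lemma is_carry_exists:
  assumes "\<forall>\<^sub>F x in at_bot. a x = 0" "\<forall>\<^sub>F x in at_bot. b x = 0"
  shows "\<exists>c. is_carry a b c"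
proof -
  have "\<forall>\<^sub>F x in at_bot. a x = 0 \<and> b x = 0"
    using assms by (rule eventually_conj)
  then obtain N :: int where N: "\<And>x. x \<le> N \<Longrightarrow> a x = 0 \<and> b x = 0"
    by (auto simp: eventually_at_bot_linorder)
  define f where
    "f = rec_nat (0::int) (\<lambda>k v. max 0 (a (N + 1 + int k) + b (N + 1 + int k) + v - 1))"
  define c where "c x = f (nat (x - N))" for x
  have z: "c x = 0" if "x \<le> N" for x
    using that by (simp add: c_def f_def)
  have "c x = max 0 (a x + b x + c (x - 1) - 1)" for x
  proof (cases "x \<le> N")
    case True
    then show ?thesis using N z by simp
  next
    case False
    then have "nat (x - N) = Suc (nat (x - 1 - N))" "N + 1 + int (nat (x - 1 - N)) = x"
      by auto
    then show ?thesis by (simp add: c_def f_def)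
  qed
  then show ?thesis
    unfolding is_carry_def eventually_at_bot_linorder using z by blast
qed

lemma is_carry_carry:
  assumes "\<forall>\<^sub>F x in at_bot. a x = 0" "\<forall>\<^sub>F x in at_bot. b x = 0"
  shows "is_carry a b (carry a b)"
  unfolding carry_def
  by (rule theI'[of "is_carry a b"]) (use is_carry_exists[OF assms] is_carry_unique in blast)

lemma conjugate_iff:
  assumes "xs \<in> signatures l" "j < l"
  shows "int j < conjugate xs x \<longleftrightarrow> x \<le> xs ! j"
proof -
  have l: "length xs = l" and s: "\<And>i k. i \<le> k \<Longrightarrow> k < l \<Longrightarrow> xs ! k \<le> xs ! i"
    using assms(1) by (auto simp: signatures_def sorted_wrt_iff_nth_less le_less)
  let ?S = "{j. j < length xs \<and> xs ! j \<ge> x}"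
  have fin: "finite ?S" by simp
  show ?thesis
  proof
    assume j: "x \<le> xs ! j"
    have "{..j} \<subseteq> ?S" using j s assms(2) l by (fastforce intro: order_trans)
    then have "card {..j} \<le> card ?S" by (rule card_mono[OF fin])
    then show "int j < conjugate xs x" by (simp add: conjugate_def)
  next
    assume j: "int j < conjugate xs x"
    show "x \<le> xs ! j"
    proof (rule ccontr)
      assume n: "\<not> x \<le> xs ! j"
      have "?S \<subseteq> {..<j}"
        using n s l assms(2) by (force simp: not_le[symmetric])
      then have "card ?S \<le> card {..<j}" by (rule card_mono[OF finite_lessThan])
      then show False using j by (simp add: conjugate_def)
    qed
  qed
qed

lemma conjugate_inject:
  assumes "xs \<in> signatures l" "ys \<in> signatures l" "\<And>x. conjugate xs x = conjugate ys x"
  shows "xs = ys"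
proof (rule nth_equalityI)
  show len: "length xs = length ys" using assms by (simp add: signatures_def)
  fix j assume "j < length xs"
  then have "j < l" using assms by (simp add: signatures_def)
  then have "x \<le> xs ! j \<longleftrightarrow> x \<le> ys ! j" for x
    using conjugate_iff assms by metis
  then show "xs ! j = ys ! j" by (meson order_antisym order_refl)
qed

lemma conjugate_antimono: "x \<le> y \<Longrightarrow> conjugate xs y \<le> conjugate xs x"
  unfolding conjugate_def by (auto intro!: card_mono)

lemma conjugate_at_bot: "\<forall>\<^sub>F x in at_bot. conjugate xs x = int (length xs)"
proof -
  have "conjugate xs x = int (length xs)" if "x \<le> Min (insert 0 (set xs))" for x
  proof -
    have "{j. j < length xs \<and> xs ! j \<ge> x} = {..<length xs}"
      using that by auto
    then show ?thesis by (simp add: conjugate_def)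
  qed
  then show ?thesis unfolding eventually_at_bot_linorder by blast
qed

lemma conjugate_at_top: "\<forall>\<^sub>F x in at_top. conjugate xs x = 0"
proof -
  have "conjugate xs x = 0" if x: "x \<ge> Max (insert 0 (set xs)) + 1" for x
  proof -
    have "xs ! j < x" if "j < length xs" for j
    proof -
      have "xs ! j \<le> Max (insert 0 (set xs))" using that by (intro Max_ge) auto
      then show ?thesis using x by linarith
    qed
    then have "{j. j < length xs \<and> xs ! j \<ge> x} = {}" by force
    then show ?thesis by (simp add: conjugate_def)
  qed
  then show ?thesis unfolding eventually_at_top_linorder by blast
qed

lemma interlaces_conjugate:
  assumes "\<kappa> \<preceq> \<mu>"
  shows "conjugate \<mu> x - conjugate \<kappa> x \<in> {0, 1}"
proof -
  let ?K = "{j. j < length \<kappa> \<and> \<kappa> ! j \<ge> x}" and ?M = "{j. j < length \<mu> \<and> \<mu> ! j \<ge> x}"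
  have "?K \<subseteq> ?M" using assms by (fastforce simp: interlaces_def)
  then have 1: "card ?K \<le> card ?M" by (intro card_mono) auto
  have "?M \<subseteq> insert 0 (Suc ` ?K)"
  proof
    fix j assume j: "j \<in> ?M"
    show "j \<in> insert 0 (Suc ` ?K)"
    proof (cases j)
      case (Suc i)
      have "\<kappa> ! i \<ge> \<mu> ! Suc i" "length \<kappa> = length \<mu>"
        using assms j Suc by (auto simp: interlaces_def)
      then show ?thesis using j Suc by auto
    qed simp
  qed
  then have "card ?M \<le> card (insert 0 (Suc ` ?K))" by (intro card_mono) auto
  also have "\<dots> = Suc (card ?K)" by (simp add: card_image)
  finally show ?thesis using 1 by (auto simp: conjugate_def)
qed

lemma signature_of_conjugate:
  fixes g :: "int \<Rightarrow> int"
  assumes mono: "\<And>x. g (x + 1) \<le> g x"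
    and bot: "\<forall>\<^sub>F x in at_bot. g x = int l" and top: "\<forall>\<^sub>F x in at_top. g x = 0"
  shows "\<exists>\<nu> \<in> signatures l. \<forall>x. conjugate \<nu> x = g x"
proof -
  have anti: "g y \<le> g x" if "x \<le> y" for x y
    using that by (induction y rule: int_ge_induct) (auto intro: order_trans[OF mono])
  obtain A where A: "\<And>x. x \<le> A \<Longrightarrow> g x = int l"
    using bot by (auto simp: eventually_at_bot_linorder)
  obtain B where B: "\<And>x. x \<ge> B \<Longrightarrow> g x = 0"
    using top by (auto simp: eventually_at_top_linorder)
  have bd: "0 \<le> g x" "g x \<le> int l" for x
    using anti[of x "max x B"] B[of "max x B"] anti[of "min x A" x] A[of "min x A"] by auto
  define S where "S j = {x \<in> {min A B..B}. int j < g x}" for j :: nat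
  define \<nu> where "\<nu> = map (\<lambda>j. Max (S j)) [0..<l]"
  have fin: "finite (S j)" for j
    unfolding S_def by (rule finite_subset[of _ "{min A B..B}"]) auto
  have ne: "S j \<noteq> {}" if "j < l" for j
    using that A[of "min A B"] by (auto simp: S_def intro!: exI[of _ "min A B"])
  have key: "x \<le> Max (S j) \<longleftrightarrow> int j < g x" if j: "j < l" for x j
  proof
    assume "x \<le> Max (S j)"
    then show "int j < g x"
      using Max_in[OF fin ne[OF j]] anti[of x "Max (S j)"] by (auto simp: S_def)
  next
    assume g: "int j < g x"
    have xB: "x \<le> B" using g B[of x] by (cases "x \<le> B") auto
    show "x \<le> Max (S j)"
    proof (cases "min A B \<le> x")
      case True
      then show ?thesis using g xB by (intro Max_ge[OF fin]) (auto simp: S_def)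
    next
      case False
      then show ?thesis using Max_in[OF fin ne[OF j]] by (auto simp: S_def)
    qed
  qed
  have "Max (S k) \<le> Max (S j)" if "j < k" "k < l" for j k
    using key[of k "Max (S k)"] key[of j "Max (S k)"] that by auto
  then have sig: "\<nu> \<in> signatures l"
    by (auto simp: signatures_def \<nu>_def sorted_wrt_iff_nth_less)
  have "conjugate \<nu> x = g x" for x
  proof -
    have "{j. j < length \<nu> \<and> \<nu> ! j \<ge> x} = {..<nat (g x)}"
      using key[of _ x] bd[of x] by (auto simp: \<nu>_def)
    then show ?thesis using bd by (simp add: conjugate_def)
  qed
  then show ?thesis using sig by blast
qed

lemma fomin_growth_spec:
  assumes sig: "\<kappa> \<in> signatures l" "\<mu> \<in> signatures l" "\<rho> \<in> signatures l"
    and il: "\<kappa> \<preceq> \<mu>" "\<kappa> \<preceq> \<rho>"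
  defines "c \<equiv> carry (\<lambda>x. conjugate \<mu> x - conjugate \<kappa> x) (\<lambda>x. conjugate \<rho> x - conjugate \<kappa> x)"
  shows "is_carry (\<lambda>x. conjugate \<mu> x - conjugate \<kappa> x) (\<lambda>x. conjugate \<rho> x - conjugate \<kappa> x) c"
    and "fomin_growth \<kappa> \<mu> \<rho> \<in> signatures l"
    and "conjugate (fomin_growth \<kappa> \<mu> \<rho>) x =
           conjugate \<mu> x + conjugate \<rho> x - conjugate \<kappa> x + c (x - 1) - c x"
proof -
  define a where "a = (\<lambda>x. conjugate \<mu> x - conjugate \<kappa> x)"
  define b where "b = (\<lambda>x. conjugate \<rho> x - conjugate \<kappa> x)"
  define k where "k = conjugate \<kappa>"
  have len: "length \<kappa> = l" "length \<mu> = l" "length \<rho> = l"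
    using sig by (auto simp: signatures_def)
  have a01: "a x \<in> {0, 1}" and b01: "b x \<in> {0, 1}" for x
    using il interlaces_conjugate by (auto simp: a_def b_def)
  have bot: "\<forall>\<^sub>F x in at_bot. a x = 0 \<and> b x = 0 \<and> k x = int l"
    using conjugate_at_bot[of \<kappa>] conjugate_at_bot[of \<mu>] conjugate_at_bot[of \<rho>]
    by eventually_elim (simp add: a_def b_def k_def len)
  have top: "\<forall>\<^sub>F x in at_top. a x = 0 \<and> b x = 0 \<and> k x = 0"
    using conjugate_at_top[of \<kappa>] conjugate_at_top[of \<mu>] conjugate_at_top[of \<rho>]
    by eventually_elim (simp add: a_def b_def k_def)
  have carry: "is_carry a b c"
    unfolding c_def a_def[symmetric] b_def[symmetric]
    by (rule is_carry_carry) (use bot in \<open>auto elim: eventually_mono\<close>)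
  then show "is_carry (\<lambda>x. conjugate \<mu> x - conjugate \<kappa> x) (\<lambda>x. conjugate \<rho> x - conjugate \<kappa> x) c"
    by (simp add: a_def b_def)
  have rec: "c x = max 0 (a x + b x + c (x - 1) - 1)" for x
    using carry unfolding is_carry_def by blast
  have c0: "0 \<le> c x" for x by (subst rec) simp
  define g where "g x = k x + a x + b x + c (x - 1) - c x" for x
  have "g (x + 1) \<le> g x" for x
  proof -
    have "k (x + 1) \<le> k x" "k (x + 1) + a (x + 1) \<le> k x + a x" "k (x + 1) + b (x + 1) \<le> k x + b x"
      using conjugate_antimono[of x "x + 1"] by (auto simp: k_def a_def b_def)
    moreover have "c (x + 1) = max 0 (a (x + 1) + b (x + 1) + c x - 1)"
      using rec[of "x + 1"] by simp
    moreover have "g (x + 1) = k (x + 1) + a (x + 1) + b (x + 1) + c x - c (x + 1)"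
      by (simp add: g_def)
    ultimately show ?thesis
      using rec[of x] c0[of x] c0[of "x - 1"] a01[of x] b01[of x] a01[of "x + 1"] b01[of "x + 1"]
      unfolding g_def[of x] insert_iff empty_iff by (smt (verit))
  qed
  moreover have "\<forall>\<^sub>F x in at_bot. g x = int l"
  proof -
    have "\<forall>\<^sub>F x in at_bot. (a x = 0 \<and> b x = 0 \<and> k x = int l) \<and> c x = 0"
      by (rule eventually_conj[OF bot]) (use carry in \<open>unfold is_carry_def, blast\<close>)
    then obtain N where "\<And>x. x \<le> N \<Longrightarrow> a x = 0 \<and> b x = 0 \<and> k x = int l \<and> c x = 0"
      unfolding eventually_at_bot_linorder by blast
    then show ?thesis
      unfolding eventually_at_bot_linorder by (intro exI[of _ N]) (auto simp: g_def)
  qed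
  moreover have "\<forall>\<^sub>F x in at_top. g x = 0"
  proof -
    obtain N where N: "\<And>x. x \<ge> N \<Longrightarrow> a x = 0 \<and> b x = 0 \<and> k x = 0"
      using top unfolding eventually_at_top_linorder by blast
    have dec: "c (N + int m) \<le> max 0 (c N - int m)" for m
    proof (induction m)
      case (Suc m)
      then show ?case using rec[of "N + int (Suc m)"] N[of "N + int (Suc m)"] by simp
    qed simp
    have z: "c x = 0" if "x \<ge> N + c N" for x
      using dec[of "nat (x - N)"] that c0[of N] c0[of x] by simp
    have "g x = 0" if "x \<ge> N + c N + 1" for x
      using that z[of x] z[of "x - 1"] N[of x] c0[of N] by (simp add: g_def)
    then show ?thesis unfolding eventually_at_top_linorder by blast
  qed
  ultimately obtain \<nu> where nu: "\<nu> \<in> signatures l" "\<And>x. conjugate \<nu> x = g x"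
    using signature_of_conjugate by blast
  have geq: "g x = conjugate \<mu> x + conjugate \<rho> x - conjugate \<kappa> x + c (x - 1) - c x" for x
    by (simp add: g_def a_def b_def k_def)
  have "fomin_growth \<kappa> \<mu> \<rho> = \<nu>"
    unfolding fomin_growth_def Let_def c_def[symmetric] geq[symmetric] len
    by (rule the_equality) (use nu conjugate_inject in auto)
  then show "fomin_growth \<kappa> \<mu> \<rho> \<in> signatures l"
    and "conjugate (fomin_growth \<kappa> \<mu> \<rho>) x =
           conjugate \<mu> x + conjugate \<rho> x - conjugate \<kappa> x + c (x - 1) - c x"
    using nu geq by auto
qed

end

theory Submission
  imports Defs
begin

text \<open>In terms of the rows of the signatures, a growth step preserves \<open>\<lambda>\<^sub>i\<close> as a solution of the discrete
  wave equation up to nonnegative carries passed from row \<open>i + 1\<close> to row \<open>i\<close>. The horizontal growth of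
  the lowest rows is therefore nonnegative and nonincreasing in the vertical direction, so only
  finitely many carries occur on the future half of the cylinder; there every row moves with a
  constant speed. The dynamics is invariant under reversing time and the order of the rows (with a
  sign), so this holds in the past as well.

  To compare the speeds, let \<open>k\<close> nonintersecting particles travel on row indices around a closed
  path of the cylinder, paying for staying on a row along a right step and for moving to the row
  above along a down step. Both sides of a plaquette give the same tropical (min-plus)
  transfer matrix, which is the tropical Lax pair of the ultradiscrete Toda lattice, so the cost of
  an optimal closed configuration does not increase in time. In the past a constant
  configuration costs the sum of the \<open>k\<close> smallest speeds, and in a carry-free region no closed
  configuration is cheaper than a sum of \<open>k\<close> speeds. Time reversal gives the opposite inequality, so
  the multisets of speeds agree.\<close>

section \<open>Growth steps in terms of rows\<close>

text \<open>Rows are indexed from \<open>0\<close>; \<open>d i\<close> is the carry passed from row \<open>i\<close> to row \<open>i - 1\<close>. The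
  conditions are invariant under negating the signatures, exchanging \<open>\<kappa>\<close> with \<open>\<nu>\<close> and reversing the
  order of the rows.\<close>

definition growth_rows ::
  "nat \<Rightarrow> (nat \<Rightarrow> int) \<Rightarrow> (nat \<Rightarrow> int) \<Rightarrow> (nat \<Rightarrow> int) \<Rightarrow> (nat \<Rightarrow> int) \<Rightarrow> (nat \<Rightarrow> int) \<Rightarrow> bool" where
  "growth_rows l \<kappa> \<mu> \<rho> \<nu> d \<longleftrightarrow> d 0 = 0 \<and> d l = 0 \<and> (\<forall>i \<le> l. 0 \<le> d i)
     \<and> (\<forall>i < l. \<kappa> i + \<nu> i + d i = \<mu> i + \<rho> i + d (Suc i))
     \<and> (\<forall>i. Suc i < l \<longrightarrow> \<nu> (Suc i) \<le> \<kappa> i \<and> (d (Suc i) = 0 \<or> \<nu> (Suc i) = \<kappa> i))"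

text \<open>On the sites \<open>x\<close> with
  \<open>\<kappa> ! i < x \<le> \<kappa> ! (i - 1)\<close> the conjugate of \<open>\<kappa>\<close>
  is constant, and \<open>a\<close>, \<open>b\<close> indicate \<open>x \<le> \<mu> ! i\<close> and
  \<open>x \<le> \<rho> ! i\<close>. So the carry recursion can be solved on each such block, and
  its values at the block ends give the row form.\<close>

lemma fomin_growth_rows:
  assumes sig: "\<kappa> \<in> signatures l" "\<mu> \<in> signatures l" "\<rho> \<in> signatures l"
    and il: "\<kappa> \<preceq> \<mu>" "\<kappa> \<preceq> \<rho>"
  shows "\<exists>d. growth_rows l ((!) \<kappa>) ((!) \<mu>) ((!) \<rho>) ((!) (fomin_growth \<kappa> \<mu> \<rho>)) d"
proof -
  define \<nu> where "\<nu> = fomin_growth \<kappa> \<mu> \<rho>"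
  define a where "a = (\<lambda>x. conjugate \<mu> x - conjugate \<kappa> x)"
  define b where "b = (\<lambda>x. conjugate \<rho> x - conjugate \<kappa> x)"
  define c where "c = carry a b"
  note spec = fomin_growth_spec[OF sig il, folded a_def b_def, folded c_def \<nu>_def]
  have nu: "\<nu> \<in> signatures l" by (rule spec(2))
  have len: "length \<kappa> = l" "length \<mu> = l" "length \<rho> = l"
    using sig by (auto simp: signatures_def)
  have rec: "c x = max 0 (a x + b x + c (x - 1) - 1)" for x
    using spec(1) unfolding is_carry_def by blast
  have c0: "0 \<le> c x" for x by (subst rec) simp
  have ab01: "a x \<in> {0, 1}" "b x \<in> {0, 1}" for x
    using il interlaces_conjugate by (auto simp: a_def b_def)
  have nuc: "conjugate \<nu> x = conjugate \<kappa> x + min 1 (a x + b x + c (x - 1))" for x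
    using spec(3)[of x] rec[of x] by (simp add: a_def b_def)
  have ka: "\<kappa> ! i \<le> \<mu> ! i" "\<kappa> ! i \<le> \<rho> ! i" if "i < l" for i
    using il that len by (auto simp: interlaces_def)
  have kb: "\<mu> ! Suc i \<le> \<kappa> ! i" "\<rho> ! Suc i \<le> \<kappa> ! i" if "Suc i < l" for i
    using il that len by (auto simp: interlaces_def)
  have row: "\<nu> ! Suc i \<le> \<kappa> ! i" if i: "Suc i < l" for i
  proof (rule ccontr)
    assume "\<not> \<nu> ! Suc i \<le> \<kappa> ! i"
    then have "\<not> int i < conjugate \<kappa> (\<nu> ! Suc i)"
      using conjugate_iff[OF sig(1), of i] i by simp
    moreover have "int (Suc i) < conjugate \<nu> (\<nu> ! Suc i)"
      using conjugate_iff[OF nu, of "Suc i"] i by simp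
    ultimately show False using nuc[of "\<nu> ! Suc i"] by simp
  qed
  have kn: "\<kappa> ! i \<le> \<nu> ! i" if i: "i < l" for i
  proof -
    have "int i < conjugate \<kappa> (\<kappa> ! i)"
      using conjugate_iff[OF sig(1) i] by simp
    then have "int i < conjugate \<nu> (\<kappa> ! i)"
      using nuc[of "\<kappa> ! i"] ab01[of "\<kappa> ! i"] c0[of "\<kappa> ! i - 1"] by auto
    then show ?thesis using conjugate_iff[OF nu i] by simp
  qed
  have blk: "conjugate \<kappa> x = int i" "a x = (if x \<le> \<mu> ! i then 1 else 0)"
    "b x = (if x \<le> \<rho> ! i then 1 else 0)"
    if i: "i < l" and x: "\<kappa> ! i < x" "\<And>j. i = Suc j \<Longrightarrow> x \<le> \<kappa> ! j" for i x
  proof -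
    have 1: "\<not> int i < conjugate \<kappa> x" using conjugate_iff[OF sig(1) i] x by simp
    have 2: "int i \<le> conjugate \<kappa> x"
    proof (cases i)
      case 0
      then show ?thesis by (simp add: conjugate_def)
    next
      case (Suc j)
      then have "int j < conjugate \<kappa> x" using conjugate_iff[OF sig(1), of j] i x by simp
      then show ?thesis using Suc by simp
    qed
    show k: "conjugate \<kappa> x = int i" using 1 2 by simp
    show "a x = (if x \<le> \<mu> ! i then 1 else 0)"
      using conjugate_iff[OF sig(2) i, of x] ab01[of x] k by (auto simp: a_def)
    show "b x = (if x \<le> \<rho> ! i then 1 else 0)"
      using conjugate_iff[OF sig(3) i, of x] ab01[of x] k by (auto simp: b_def)
  qed
  \<comment> \<open>Along a block \<open>a + b - 1\<close> takes the values 1, 0, -1 in this order,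
    so the carry never rises again once it has started to fall. Truncating at 0 once, at the end, is
    therefore enough.\<close>
  have cform: "c x = max 0 (c (\<kappa> ! i) + min x (\<mu> ! i) + min x (\<rho> ! i) - \<kappa> ! i - x)"
    if i: "i < l" and x: "\<kappa> ! i \<le> x" "\<And>j. i = Suc j \<Longrightarrow> x \<le> \<kappa> ! j" for i x
    using x
  proof (induction x rule: int_ge_induct)
    case base
    then show ?case using ka[OF i] c0[of "\<kappa> ! i"] by simp
  next
    case (step x)
    have "x \<le> \<kappa> ! j" if "i = Suc j" for j using step.prems[OF that] by simp
    note IH = step.IH[OF this]
    have "\<kappa> ! i < x + 1" using step.hyps by simp
    note B = blk[OF i this step.prems]
    show ?case
      using rec[of "x + 1"] B(2,3) IH ka[OF i] c0[of "\<kappa> ! i"] step.hyps by (auto simp: max_def min_def)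
  qed
  have low: "c (\<kappa> ! (l - 1)) = 0" if "l > 0"
  proof -
    obtain N where N: "\<And>x. x \<le> N \<Longrightarrow> c x = 0"
      using spec(1) unfolding is_carry_def eventually_at_bot_linorder by blast
    have z: "a x = 0" "b x = 0" if x: "x \<le> \<kappa> ! (l - 1)" for x
    proof -
      have 1: "l - 1 < l" using \<open>l > 0\<close> by simp
      have "conjugate \<kappa> x \<ge> int l"
        using conjugate_iff[OF sig(1) 1, of x] x \<open>l > 0\<close> by simp
      moreover have le: "conjugate xs x \<le> int (length xs)" for xs
      proof -
        have "card {j. j < length xs \<and> xs ! j \<ge> x} \<le> card {..<length xs}"
          by (rule card_mono) auto
        then show ?thesis by (simp add: conjugate_def)
      qed
      ultimately show "a x = 0" "b x = 0"
        using ab01[of x] len le[of \<mu>] le[of \<rho>] by (auto simp: a_def b_def)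
    qed
    have "x \<le> \<kappa> ! (l - 1) \<longrightarrow> c x = 0" if "min N (\<kappa> ! (l - 1)) \<le> x" for x
      using that
    proof (induction x rule: int_ge_induct)
      case base
      then show ?case using N by simp
    next
      case (step x)
      then show ?case using rec[of "x + 1"] z[of "x + 1"] by auto
    qed
    then show ?thesis by simp
  qed
  \<comment> \<open>The sites belonging to row \<open>i\<close> are those between \<open>\<kappa> ! i\<close> and \<open>\<kappa> ! (i - 1)\<close>, so the carry leaving
    row \<open>i\<close> is read off at the site \<open>\<kappa> ! (i - 1)\<close>; above row \<open>0\<close> everything is deposited.\<close>
  define d where "d i = (case i of 0 \<Rightarrow> 0 | Suc j \<Rightarrow> c (\<kappa> ! j))" for i
  have key: "x \<le> \<nu> ! i \<longleftrightarrow> x \<le> c (\<kappa> ! i) + \<mu> ! i + \<rho> ! i - \<kappa> ! i"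
    if i: "i < l" and x: "\<kappa> ! i < x" "\<And>j. i = Suc j \<Longrightarrow> x \<le> \<kappa> ! j" for i x
  proof -
    note B = blk[OF i x]
    have "c (x - 1) = max 0 (c (\<kappa> ! i) + min (x - 1) (\<mu> ! i) + min (x - 1) (\<rho> ! i)
        - \<kappa> ! i - (x - 1))"
      using x by (intro cform[OF i]) (auto intro: order_trans[of "x - 1" x])
    moreover have "x \<le> \<nu> ! i \<longleftrightarrow> int i < conjugate \<nu> x" using conjugate_iff[OF nu i] by simp
    moreover have "\<dots> \<longleftrightarrow> a x + b x + c (x - 1) \<ge> 1" using nuc[of x] B(1) by auto
    ultimately show ?thesis using B(2,3) ka[OF i] c0[of "\<kappa> ! i"] by (auto simp: max_def min_def)
  qed
  have bal0: "\<nu> ! i = c (\<kappa> ! i) + \<mu> ! i + \<rho> ! i - \<kappa> ! i" if i: "i < l" "i = 0" for i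
    using key[OF i(1), of "\<nu> ! i"] key[OF i(1), of "c (\<kappa> ! i) + \<mu> ! i + \<rho> ! i - \<kappa> ! i"]
      key[OF i(1), of "\<kappa> ! i + 1"] kn[OF i(1)] ka[OF i(1)] c0[of "\<kappa> ! i"] i(2) by force
  \<comment> \<open>The row is cut off at the end of its block; by \<open>cS\<close> the excess is
    what is carried into the next block.\<close>
  have balS: "\<nu> ! Suc i = min (c (\<kappa> ! Suc i) + \<mu> ! Suc i + \<rho> ! Suc i - \<kappa> ! Suc i) (\<kappa> ! i)"
    if i: "Suc i < l" for i
  proof -
    let ?u = "c (\<kappa> ! Suc i) + \<mu> ! Suc i + \<rho> ! Suc i - \<kappa> ! Suc i"
    have 1: "\<kappa> ! Suc i \<le> ?u" "\<kappa> ! Suc i \<le> \<kappa> ! i"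
      using ka[OF i] kb[OF i] c0[of "\<kappa> ! Suc i"] by auto
    have K: "x \<le> \<nu> ! Suc i \<longleftrightarrow> x \<le> ?u" if "\<kappa> ! Suc i < x" "x \<le> \<kappa> ! i" for x
      using key[OF i that(1)] that(2) by simp
    show ?thesis
      using K[of "\<nu> ! Suc i"] K[of "min ?u (\<kappa> ! i)"] K[of "\<kappa> ! Suc i + 1"] kn[OF i] row[OF i] 1
      by (smt (verit))
  qed
  have cS: "c (\<kappa> ! i) = max 0 (c (\<kappa> ! Suc i) + \<mu> ! Suc i + \<rho> ! Suc i - \<kappa> ! Suc i - \<kappa> ! i)"
    if i: "Suc i < l" for i
  proof -
    have "\<kappa> ! Suc i \<le> \<kappa> ! i" using ka[OF i] kb[OF i] by linarith
    from cform[OF i this] show ?thesis using kb[OF i] by simp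
  qed
  have "growth_rows l ((!) \<kappa>) ((!) \<mu>) ((!) \<rho>) ((!) \<nu>) d"
    unfolding growth_rows_def
  proof (intro conjI allI impI)
    show "d l = 0" using low by (cases l) (simp_all add: d_def)
    show "0 \<le> d i" for i by (simp add: d_def c0 split: nat.split)
    show "\<kappa> ! i + \<nu> ! i + d i = \<mu> ! i + \<rho> ! i + d (Suc i)" if "i < l" for i
    proof (cases i)
      case 0
      then show ?thesis using bal0[of i] that by (simp add: d_def)
    next
      case (Suc j)
      then show ?thesis using balS[of j] cS[of j] that by (simp add: d_def)
    qed
    show "d (Suc i) = 0 \<or> \<nu> ! Suc i = \<kappa> ! i" if "Suc i < l" for i
      using balS[OF that] cS[OF that] by (auto simp: d_def)
  qed (use row in \<open>auto simp: d_def\<close>)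
  then show ?thesis unfolding \<nu>_def by blast
qed

subsection \<open>Nonintersecting particles on the rows\<close>

text \<open>Hops are the finite entries, and costs their values, of bidiagonal min-plus matrices:
  upper bidiagonal for right steps, lower bidiagonal for down steps.\<close>

definition right_hop :: "nat \<Rightarrow> nat \<Rightarrow> bool" where
  "right_hop i j \<longleftrightarrow> j = i \<or> j = Suc i"

definition right_cost :: "(nat \<Rightarrow> int) \<Rightarrow> (nat \<Rightarrow> int) \<Rightarrow> nat \<Rightarrow> nat \<Rightarrow> int" where
  "right_cost \<kappa> \<mu> i j = (if j = i then \<mu> i - \<kappa> i else 0)"

definition down_hop :: "nat \<Rightarrow> nat \<Rightarrow> bool" where
  "down_hop i j \<longleftrightarrow> j = i \<or> i = Suc j"

definition down_cost :: "(nat \<Rightarrow> int) \<Rightarrow> (nat \<Rightarrow> int) \<Rightarrow> nat \<Rightarrow> nat \<Rightarrow> int" where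
  "down_cost \<kappa> \<rho> i j = (if j = i then 0 else \<kappa> j - \<rho> i)"

text \<open>Strict order in the list encodes nonintersection: particles are matched by position in
  \<open>list_all2\<close> and never change their order.\<close>

definition config :: "nat \<Rightarrow> nat list \<Rightarrow> bool" where
  "config l I \<longleftrightarrow> sorted_wrt (<) I \<and> set I \<subseteq> {..<l}"

text \<open>The configuration \<open>K'\<close> is chosen particle by particle, starting from the last one. A particle that
  rests on row \<open>i\<close> in the given configuration may hop along the saturated rows for free;
  otherwise resting again saves the carry \<open>d i\<close>, which pays for resting on the row above. The
  conclusion on \<open>hd K'\<close> records this alternative for the induction.\<close>

lemma exchange_aux:
  assumes g: "growth_rows l \<kappa> \<mu> \<rho> \<nu> d"
    and "list_all2 down_hop I K" "list_all2 right_hop K J" "config l I" "config l K" "config l J"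
  shows "\<exists>K'. list_all2 right_hop I K' \<and> list_all2 down_hop K' J \<and> config l K' \<and>
    (let W = sum_list (map2 (down_cost \<kappa> \<rho>) I K) + sum_list (map2 (right_cost \<kappa> \<mu>) K J);
         W' = sum_list (map2 (right_cost \<rho> \<nu>) I K') + sum_list (map2 (down_cost \<mu> \<nu>) K' J)
     in W' \<le> W \<and> (I \<noteq> [] \<and> hd K = hd I \<and> hd J = hd I \<longrightarrow> hd K' = Suc (hd I) \<or> W' + d (hd I) \<le> W))"
  using assms(2-)
proof (induction I arbitrary: K J)
  case Nil
  then show ?case by (auto simp: config_def)
next
  case (Cons i I K0 J0)
  obtain k K where K0: "K0 = k # K" "down_hop i k" "list_all2 down_hop I K"
    using Cons.prems(1) by (auto simp: list_all2_Cons1)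
  obtain j J where J0: "J0 = j # J" "right_hop k j" "list_all2 right_hop K J"
    using Cons.prems(2) K0 by (auto simp: list_all2_Cons1)
  have cI: "config l I" "i < l" "\<And>z. z \<in> set I \<Longrightarrow> i < z"
    and cK: "config l K" "k < l" "\<And>z. z \<in> set K \<Longrightarrow> k < z"
    and cJ: "config l J" "j < l" "\<And>z. z \<in> set J \<Longrightarrow> j < z"
    using Cons.prems K0 J0 by (auto simp: config_def)
  define W where "W = sum_list (map2 (down_cost \<kappa> \<rho>) I K) + sum_list (map2 (right_cost \<kappa> \<mu>) K J)"
  define W' where "W' K' = sum_list (map2 (right_cost \<rho> \<nu>) I K') + sum_list (map2 (down_cost \<mu> \<nu>) K' J)" for K'
  obtain K' where K': "list_all2 right_hop I K'" "list_all2 down_hop K' J" "config l K'"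
      "W' K' \<le> W" "I \<noteq> [] \<and> hd K = hd I \<and> hd J = hd I \<Longrightarrow> hd K' = Suc (hd I) \<or> W' K' + d (hd I) \<le> W"
    using Cons.IH[OF K0(3) J0(3) cI(1) cK(1) cJ(1)] unfolding Let_def W_def W'_def by blast
  have dn: "0 \<le> d m" if "m \<le> l" for m using g that by (auto simp: growth_rows_def)
  have bal: "\<kappa> i + \<nu> i + d i = \<mu> i + \<rho> i + d (Suc i)"
    using g cI(2) by (auto simp: growth_rows_def)
  \<comment> \<open>Right hops do not decrease the row, so \<open>i\<close> itself is always free
    for the first particle; only \<open>Suc i\<close> can be blocked.\<close>
  have lt: "i < z" if z: "z \<in> set K'" for z
  proof -
    obtain m where m: "m < length K'" "z = K' ! m"
      using z unfolding in_set_conv_nth by blast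
    have "right_hop (I ! m) z" "length I = length K'"
      using list_all2_nthD2[OF K'(1) m(1)] list_all2_lengthD[OF K'(1)] m(2) by auto
    moreover from this have "i < I ! m" using m(1) by (intro cI(3)) simp
    ultimately show ?thesis unfolding right_hop_def by linarith
  qed
  have split: "I = [] \<and> K = [] \<and> J = [] \<and> K' = [] \<or>
     (\<exists>i2 I2 k2 K2 j2 J2 k3 K3. I = i2 # I2 \<and> K = k2 # K2 \<and> J = j2 # J2 \<and> K' = k3 # K3 \<and>
        down_hop i2 k2 \<and> right_hop k2 j2 \<and> right_hop i2 k3 \<and> down_hop k3 j2 \<and>
        i < i2 \<and> k < k2 \<and> j < j2 \<and> (\<forall>z\<in>set K3. k3 < z))"
    (is "_ \<or> ?S")
  proof (cases I)
    case Nil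
    then show ?thesis using K0(3) J0(3) K'(1,2) by simp
  next
    case (Cons i2 I2)
    obtain k2 K2 where k: "K = k2 # K2" "down_hop i2 k2"
      using K0(3) Cons by (auto simp: list_all2_Cons1)
    obtain j2 J2 where j: "J = j2 # J2" "right_hop k2 j2"
      using J0(3) k by (auto simp: list_all2_Cons1)
    obtain k3 K3 where k3: "K' = k3 # K3" "right_hop i2 k3"
      using K'(1) Cons by (auto simp: list_all2_Cons1)
    have "down_hop k3 j2" "\<forall>z\<in>set K3. k3 < z"
      using K'(2,3) k3 j by (auto simp: config_def)
    then have ?S using Cons k j k3 cI(3) cK(3) cJ(3) by simp
    then show ?thesis ..
  qed
  \<comment> \<open>It remains to choose the intermediate row \<open>m\<close> of the first
    particle.\<close>
  have fin: ?case
    if h: "right_hop i m" "down_hop m j" "m < l" "\<And>z. z \<in> set K' \<Longrightarrow> m < z"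
      and w: "right_cost \<rho> \<nu> i m + down_cost \<mu> \<nu> m j + W' K' \<le> down_cost \<kappa> \<rho> i k + right_cost \<kappa> \<mu> k j + W"
      and e: "k = i \<Longrightarrow> j = i \<Longrightarrow> m = Suc i \<or>
        right_cost \<rho> \<nu> i m + down_cost \<mu> \<nu> m j + W' K' + d i \<le> down_cost \<kappa> \<rho> i k + right_cost \<kappa> \<mu> k j + W"
    for m
  proof -
    have "config l (m # K')" using K'(3) h(3,4) by (auto simp: config_def)
    then show ?thesis
      using h(1,2) K'(1,2) w e unfolding K0(1) J0(1) W_def W'_def Let_def
      by (intro exI[of _ "m # K'"]) (auto simp: algebra_simps)
  qed
  note costs = right_hop_def down_hop_def right_cost_def down_cost_def
  consider "k = i" "j = Suc i" | "k = j" "i = Suc j" | "i = Suc k" "j = i" | "k = i" "j = i"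
    using K0(2) J0(2) by (auto simp: down_hop_def right_hop_def)
  then show ?case
  proof cases
    case 1
    have "Suc i < z" if "z \<in> set K'" for z
      using split that 1 by (auto simp: right_hop_def down_hop_def dest!: bspec)
    note z = this
    show ?thesis
    proof (rule fin[of "Suc i"])
      show "right_hop i (Suc i)" "down_hop (Suc i) j" "Suc i < l" using 1 cJ(2) by (auto simp: costs)
      show "Suc i < z" if "z \<in> set K'" for z using z that .
      show "right_cost \<rho> \<nu> i (Suc i) + down_cost \<mu> \<nu> (Suc i) j + W' K'
          \<le> down_cost \<kappa> \<rho> i k + right_cost \<kappa> \<mu> k j + W"
        using 1 K'(4) by (simp add: costs)
    qed simp
  next
    case 2
    show ?thesis
    proof (rule fin[of i])
      show "right_hop i i" "down_hop i j" "i < l" using 2 cI(2) by (auto simp: costs)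
      show "right_cost \<rho> \<nu> i i + down_cost \<mu> \<nu> i j + W' K'
          \<le> down_cost \<kappa> \<rho> i k + right_cost \<kappa> \<mu> k j + W"
        using 2 K'(4) by (simp add: costs)
      show "i = Suc i \<or> right_cost \<rho> \<nu> i i + down_cost \<mu> \<nu> i j + W' K' + d i
          \<le> down_cost \<kappa> \<rho> i k + right_cost \<kappa> \<mu> k j + W"
        if "k = i" "j = i"
        using 2 that by (metis n_not_Suc_n)
    qed (rule lt)
  next
    case 3
    have nu: "\<nu> i \<le> \<kappa> k" using g 3 cI(2) by (auto simp: growth_rows_def)
    show ?thesis
    proof (rule fin[of i])
      show "right_hop i i" "down_hop i j" "i < l" using 3 cI(2) by (auto simp: costs)
      show "right_cost \<rho> \<nu> i i + down_cost \<mu> \<nu> i j + W' K'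
          \<le> down_cost \<kappa> \<rho> i k + right_cost \<kappa> \<mu> k j + W"
        using 3 K'(4) nu by (simp add: costs)
      show "i = Suc i \<or> right_cost \<rho> \<nu> i i + down_cost \<mu> \<nu> i j + W' K' + d i
          \<le> down_cost \<kappa> \<rho> i k + right_cost \<kappa> \<mu> k j + W"
        if "k = i" "j = i"
        using 3 that by (metis n_not_Suc_n)
    qed (rule lt)
  next
    case 4
    show ?thesis
    proof (cases "Suc i < l \<and> \<nu> (Suc i) = \<kappa> i \<and> (\<forall>z\<in>set K'. Suc i < z)")
      case True
      show ?thesis
      proof (rule fin[of "Suc i"])
        show "right_hop i (Suc i)" "down_hop (Suc i) j" "Suc i < l" using 4 True by (auto simp: costs)
        show "Suc i < z" if "z \<in> set K'" for z using True that by blast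
        show "right_cost \<rho> \<nu> i (Suc i) + down_cost \<mu> \<nu> (Suc i) j + W' K'
            \<le> down_cost \<kappa> \<rho> i k + right_cost \<kappa> \<mu> k j + W"
          using 4 K'(4) True by (simp add: costs)
      qed simp
    next
      case False
      \<comment> \<open>If \<open>d (Suc i)\<close> is nonzero, row \<open>Suc i\<close> is
        saturated and must be blocked by the next particle. The order of the particles forces that
        one to rest on \<open>Suc i\<close> throughout, so the induction hypothesis saves
        \<open>d (Suc i)\<close>.\<close>
      have dS: "d (Suc i) + W' K' \<le> W"
      proof (cases "d (Suc i) = 0")
        case True
        then show ?thesis using K'(4) by simp
      next
        case d: False
        have "Suc i < l"
          using d g cI(2) by (cases "Suc i = l") (auto simp: growth_rows_def)
        moreover from this have "\<nu> (Suc i) = \<kappa> i" using d g by (auto simp: growth_rows_def)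
        ultimately obtain z where "z \<in> set K'" "z \<le> Suc i" using False by force
        then have "Suc i \<in> set K'" using lt[of z] by (simp add: le_Suc_eq)
        then show ?thesis
          using split K'(5) 4 by (auto simp: right_hop_def down_hop_def dest!: bspec)
      qed
      show ?thesis
      proof (rule fin[of i])
        show "right_hop i i" "down_hop i j" "i < l" using 4 cI(2) by (auto simp: costs)
        have *: "right_cost \<rho> \<nu> i i + down_cost \<mu> \<nu> i j + W' K' + d i
            \<le> down_cost \<kappa> \<rho> i k + right_cost \<kappa> \<mu> k j + W"
          using 4 dS bal by (simp add: costs)
        then show "right_cost \<rho> \<nu> i i + down_cost \<mu> \<nu> i j + W' K'
            \<le> down_cost \<kappa> \<rho> i k + right_cost \<kappa> \<mu> k j + W"
          using dn[of i] cI(2) by linarith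
        show "i = Suc i \<or> right_cost \<rho> \<nu> i i + down_cost \<mu> \<nu> i j + W' K' + d i
            \<le> down_cost \<kappa> \<rho> i k + right_cost \<kappa> \<mu> k j + W"
          using * ..
      qed (rule lt)
    qed
  qed
qed

lemma exchange:
  assumes "growth_rows l \<kappa> \<mu> \<rho> \<nu> d"
    and "list_all2 down_hop I K" "list_all2 right_hop K J" "config l I" "config l K" "config l J"
  obtains K' where "list_all2 right_hop I K'" "list_all2 down_hop K' J" "config l K'"
    "sum_list (map2 (right_cost \<rho> \<nu>) I K') + sum_list (map2 (down_cost \<mu> \<nu>) K' J)
       \<le> sum_list (map2 (down_cost \<kappa> \<rho>) I K) + sum_list (map2 (right_cost \<kappa> \<mu>) K J)"
  using exchange_aux[OF assms] unfolding Let_def by blast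

subsection \<open>Carries die out\<close>

text \<open>The field is lifted to the plane, where the cylinder becomes \<open>periodic\<close>.
  The carries are a parameter, so that time reversal can name those of the reversed field.\<close>

locale rows_field =
  fixes n l :: nat and G :: "int \<Rightarrow> int \<Rightarrow> nat \<Rightarrow> int" and d :: "int \<Rightarrow> int \<Rightarrow> nat \<Rightarrow> int"
  assumes n_pos: "n > 0"
    and periodic: "G (x + int n) y = G x (y + int n)"
    and mono_x: "i < l \<Longrightarrow> G x y i \<le> G (x + 1) y i"
    and rows_antimono: "Suc i < l \<Longrightarrow> G x y (Suc i) \<le> G x y i"
    and growth: "growth_rows l (G x y) (G (x + 1) y) (G x (y + 1)) (G (x + 1) (y + 1)) (d x y)"
begin

lemma balance:
  "i < l \<Longrightarrow> G x y i + G (x + 1) (y + 1) i + d x y i = G (x + 1) y i + G x (y + 1) i + d x y (Suc i)"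
  using growth unfolding growth_rows_def by blast

lemma d_bounds: "d x y 0 = 0" "d x y l = 0" "i \<le> l \<Longrightarrow> 0 \<le> d x y i"
  using growth unfolding growth_rows_def by blast+

lemma diagonal_le: "Suc i < l \<Longrightarrow> G (x + 1) (y + 1) (Suc i) \<le> G x y i"
  using growth unfolding growth_rows_def by blast

lemma saturated: "Suc i < l \<Longrightarrow> d x y (Suc i) = 0 \<or> G (x + 1) (y + 1) (Suc i) = G x y i"
  using growth unfolding growth_rows_def by blast

lemma rows_antimono': "i \<le> j \<Longrightarrow> j < l \<Longrightarrow> G x y j \<le> G x y i"
  by (induction j rule: dec_induct) (auto intro: order_trans[OF rows_antimono])

text \<open>The balance determines the carries from the field, starting with
  \<open>d x y 0 = 0\<close>.\<close>

lemma d_periodic: "i \<le> l \<Longrightarrow> d (x + int n) y i = d x (y + int n) i"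
proof (induction i)
  case (Suc i)
  then have i: "i < l" by simp
  have "G (x + int n + 1) y i = G (x + 1) (y + int n) i"
    "G (x + int n + 1) (y + 1) i = G (x + 1) (y + int n + 1) i"
    "G (x + int n) (y + 1) i = G x (y + int n + 1) i"
    using periodic[of "x + 1" y] periodic[of "x + 1" "y + 1"] periodic[of x "y + 1"]
    by (simp_all add: ac_simps)
  then show ?case
    using balance[OF i, of "x + int n" y] balance[OF i, of x "y + int n"] periodic[of x y] Suc.IH i
    by simp
qed (simp add: d_bounds)

text \<open>A half turn of the plane, with sign and row order reversed. The plaquette at
  \<open>(x, y)\<close> comes from the one at \<open>(- x - 1, - y - 1)\<close>; carries sit between
  rows, hence \<open>l - i\<close> against \<open>l - 1 - i\<close> for rows.\<close>

lemma dual: "rows_field n l (\<lambda>x y i. - G (- x) (- y) (l - 1 - i)) (\<lambda>x y i. d (- x - 1) (- y - 1) (l - i))"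
proof
  fix x y :: int and i :: nat
  show "(\<lambda>i. - G (- (x + int n)) (- y) (l - 1 - i)) = (\<lambda>i. - G (- x) (- (y + int n)) (l - 1 - i))"
    using periodic[of "- x - int n" "- y - int n"] by (simp add: algebra_simps)
  define X Y where "X = - x - 1" and "Y = - y - 1"
  have e: "- x = X + 1" "- y = Y + 1" "- (x + 1) = X" "- (y + 1) = Y" "X + 1 - 1 = X" "Y + 1 - 1 = Y"
    by (simp_all add: X_def Y_def)
  show "- G (- x) (- y) (l - 1 - i) \<le> - G (- (x + 1)) (- y) (l - 1 - i)" if "i < l"
    using mono_x[of "l - 1 - i" X "Y + 1"] that unfolding e by simp
  show "- G (- x) (- y) (l - 1 - Suc i) \<le> - G (- x) (- y) (l - 1 - i)" if "Suc i < l"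
    using rows_antimono[of "l - 1 - Suc i" "- x" "- y"] that by (simp add: Suc_diff_Suc)
  show "growth_rows l (\<lambda>i. - G (- x) (- y) (l - 1 - i)) (\<lambda>i. - G (- (x + 1)) (- y) (l - 1 - i))
     (\<lambda>i. - G (- x) (- (y + 1)) (l - 1 - i)) (\<lambda>i. - G (- (x + 1)) (- (y + 1)) (l - 1 - i))
     (\<lambda>i. d (- x - 1) (- y - 1) (l - i))"
    unfolding growth_rows_def e
  proof (intro conjI allI impI)
    fix i assume i: "i < l"
    then have s: "Suc (l - 1 - i) = l - i" "l - Suc i = l - 1 - i" "l - 1 - i < l" by simp_all
    show "- G (X + 1) (Y + 1) (l - 1 - i) + - G X Y (l - 1 - i) + d X Y (l - i)
        = - G X (Y + 1) (l - 1 - i) + - G (X + 1) Y (l - 1 - i) + d X Y (l - Suc i)"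
      using balance[OF s(3), of X Y] unfolding s(1,2) by linarith
  next
    fix i assume i: "Suc i < l"
    then have s: "Suc (l - 1 - Suc i) = l - 1 - i" "l - Suc i = l - 1 - i" "Suc (l - 1 - Suc i) < l"
      by simp_all
    show "- G X Y (l - 1 - Suc i) \<le> - G (X + 1) (Y + 1) (l - 1 - i)"
      using diagonal_le[OF s(3), of X Y] unfolding s(1) by linarith
    show "d X Y (l - Suc i) = 0 \<or> - G X Y (l - 1 - Suc i) = - G (X + 1) (Y + 1) (l - 1 - i)"
      using saturated[OF s(3), of X Y] unfolding s(1,2) by auto
  qed (simp_all add: d_bounds)
qed (rule n_pos)

definition free_from :: "int \<Rightarrow> bool" where
  "free_from T \<longleftrightarrow> (\<forall>x y i. T \<le> x + y \<longrightarrow> i \<le> l \<longrightarrow> d x y i = 0)"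

definition speeds_from :: "int \<Rightarrow> (nat \<Rightarrow> int) \<Rightarrow> bool" where
  "speeds_from T M \<longleftrightarrow> (\<forall>x y i. T \<le> x + y \<longrightarrow> i < l \<longrightarrow> G (x + int n) y i = G x y i + M i)"

lemma antimono_nonneg_eventually_const:
  fixes f :: "nat \<Rightarrow> int"
  assumes "\<And>m. f (Suc m) \<le> f m" "\<And>m. 0 \<le> f m"
  shows "\<exists>N. \<forall>m\<ge>N. f (Suc m) = f m"
proof -
  obtain N where N: "\<And>m. nat (f N) \<le> nat (f m)"
    using ex_has_least_nat[of "\<lambda>_. True" 0 "\<lambda>m. nat (f m)"] by blast
  have "f N \<le> f m" for m using N[of m] assms(2)[of m] by simp
  moreover have "f m \<le> f N" if "N \<le> m" for m
    using that by (induction m rule: dec_induct) (auto intro: order_trans[OF assms(1)])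
  ultimately have "f m = f N" if "N \<le> m" for m using that by (simp add: antisym)
  then show ?thesis by (metis le_SucI)
qed

text \<open>The horizontal growth of the rows from \<open>k\<close> on is nonnegative and drops by the carry \<open>d k\<close>
  leaving them whenever \<open>y\<close> increases, so only finitely many carries occur.\<close>

lemma column_free: "\<exists>N. \<forall>y\<ge>N. \<forall>i\<le>l. d x y i = 0"
proof -
  define f where "f k y = (\<Sum>i=k..<l. G (x + 1) (int y) i - G x (int y) i)" for k and y :: nat
  have dk: "f k (Suc y) = f k y - d x (int y) k" if k: "k \<le> l" for k y
  proof -
    have "f k (Suc y) - f k y = (\<Sum>i=k..<l. d x (int y) (Suc i) - d x (int y) i)"
      unfolding f_def sum_subtractf[symmetric]
      by (rule sum.cong) (use balance[of _ x "int y"] in \<open>auto simp: algebra_simps\<close>)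
    also have "\<dots> = d x (int y) l - d x (int y) k"
      using k by (simp add: sum_Suc_diff')
    finally show ?thesis by (simp add: d_bounds)
  qed
  have "\<exists>N. \<forall>y\<ge>N. f k (Suc y) = f k y" if k: "k \<le> l" for k
  proof (rule antimono_nonneg_eventually_const)
    show "f k (Suc y) \<le> f k y" for y using dk[OF k, of y] d_bounds(3)[OF k, of x "int y"] by simp
    show "0 \<le> f k y" for y unfolding f_def by (intro sum_nonneg) (use mono_x in auto)
  qed
  then have "\<forall>k. \<exists>N. k \<le> l \<longrightarrow> (\<forall>y\<ge>N. d x (int y) k = 0)" using dk by force
  then obtain N where N: "\<And>k y. k \<le> l \<Longrightarrow> N k \<le> y \<Longrightarrow> d x (int y) k = 0" by metis
  have "d x y k = 0" if "int (Max (N ` {..l})) \<le> y" "k \<le> l" for y k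
  proof -
    have "N k \<le> Max (N ` {..l})" using that(2) by (intro Max_ge) auto
    then show ?thesis using N[OF that(2), of "nat y"] that(1) by simp
  qed
  then show ?thesis by blast
qed

text \<open>By periodicity it suffices to apply \<open>column_free\<close> to \<open>n\<close>
  consecutive columns.\<close>

lemma ex_free_from: "\<exists>T. free_from T"
proof -
  obtain N where N: "\<And>x y i. N x \<le> y \<Longrightarrow> i \<le> l \<Longrightarrow> d x y i = 0" using column_free by metis
  define Y where "Y = Max (N ` {0..<int n})"
  have Y: "d x y i = 0" if "0 \<le> x" "x < int n" "Y \<le> y" "i \<le> l" for x y i
  proof -
    have "N x \<le> Y" unfolding Y_def using that by (intro Max_ge) auto
    then show ?thesis using N that by (meson order_trans)
  qed
  have shift: "d (x + int m * int n) y i = d x (y + int m * int n) i" if "i \<le> l" for x y i m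
  proof (induction m arbitrary: y)
    case (Suc m)
    have "d (x + int (Suc m) * int n) y i = d (x + int m * int n + int n) y i"
      by (simp add: algebra_simps)
    also have "\<dots> = d (x + int m * int n) (y + int n) i" by (rule d_periodic[OF that])
    also have "\<dots> = d x (y + int (Suc m) * int n) i" by (simp add: Suc algebra_simps)
    finally show ?case .
  qed simp
  \<comment> \<open>Moving to column \<open>r\<close> preserves \<open>x + y\<close>, so the new
    ordinate is \<open>x + y - r\<close>; the summand \<open>int n\<close> compensates for
    \<open>r < n\<close>.\<close>
  have "d x y i = 0" if xy: "Y + int n \<le> x + y" and i: "i \<le> l" for x y i
  proof -
    define q r where "q = x div int n" and "r = x mod int n"
    have r: "0 \<le> r" "r < int n" and x: "x = r + q * int n" using n_pos by (auto simp: q_def r_def)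
    have "d x y i = d r (y + q * int n) i"
    proof (cases "q \<ge> 0")
      case True
      then show ?thesis using shift[OF i, of r "nat q" y] x by simp
    next
      case False
      then show ?thesis using shift[OF i, of x "nat (- q)" "y + q * int n"] x by simp
    qed
    also have "\<dots> = 0" using r xy x i by (intro Y) auto
    finally show ?thesis .
  qed
  then show ?thesis unfolding free_from_def by blast
qed

text \<open>Without carries, horizontal increments do not depend on \<open>y\<close> and vertical
  ones not on \<open>x\<close>. By periodicity \<open>D\<close> is an increment of both kinds, hence
  constant.\<close>

lemma ex_speeds_from: 
  assumes T: "free_from T"
  shows "\<exists>M. speeds_from T M"
proof -
  define D where "D x y i = G (x + int n) y i - G x y i" for x y i
  have free: "G (x + 1) (y + 1) i - G x (y + 1) i = G (x + 1) y i - G x y i"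
    if "T \<le> x + y" "i < l" for x y i
    using balance[OF that(2), of x y] T that unfolding free_from_def by simp
  have rowstep: "G (x + int m) (y + 1) i - G x (y + 1) i = G (x + int m) y i - G x y i"
    if "T \<le> x + y" "i < l" for x y i m
  proof (induction m)
    case (Suc m)
    then show ?case using free[of "x + int m" y i] that by (simp add: algebra_simps)
  qed simp
  have colstep: "G (x + 1) (y + int m) i - G (x + 1) y i = G x (y + int m) i - G x y i"
    if "T \<le> x + y" "i < l" for x y i m
  proof (induction m)
    case (Suc m)
    then show ?case using free[of x "y + int m" i] that by (simp add: algebra_simps)
  qed simp
  have Dy: "D x (y + 1) i = D x y i" if "T \<le> x + y" "i < l" for x y i
    using rowstep[OF that, of n] by (simp add: D_def)
  have Dx: "D (x + 1) y i = D x y i" if "T \<le> x + y" "i < l" for x y i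
    using colstep[OF that, of n] periodic by (simp add: D_def)
  have Dym: "D x (y + int m) i = D x y i" if "T \<le> x + y" "i < l" for x y i m
  proof (induction m)
    case (Suc m)
    then show ?case using Dy[of x "y + int m" i] that by (simp add: algebra_simps)
  qed simp
  have Dxm: "D (x + int m) y i = D x y i" if "T \<le> x + y" "i < l" for x y i m
  proof (induction m)
    case (Suc m)
    then show ?case using Dx[of "x + int m" y i] that by (simp add: algebra_simps)
  qed simp
  \<comment> \<open>The path from \<open>(x, y)\<close> to \<open>(T, 0)\<close> goes through
    \<open>(max x T, y)\<close>, \<open>(max x T, max y 0)\<close> and \<open>(max x T, 0)\<close>,
    and thus stays in the half plane.\<close>
  have const: "D x y i = D T 0 i" if "T \<le> x + y" "i < l" for x y i
  proof -
    have "D x y i = D (x + int (nat (T - x))) y i" by (rule Dxm[OF that, symmetric])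
    also have "\<dots> = D (x + int (nat (T - x))) (y + int (nat (- y))) i"
      using that by (intro Dym[symmetric]) auto
    also have "\<dots> = D (T + int (nat (x - T))) (int (nat y)) i"
      by (rule arg_cong2[where f = "\<lambda>a b. D a b i"]) auto
    also have "\<dots> = D (T + int (nat (x - T))) 0 i"
      using Dym[of "T + int (nat (x - T))" 0 i "nat y"] that(2) by (simp only: add_0)
    also have "\<dots> = D T 0 i" using that by (intro Dxm) auto
    finally show ?thesis .
  qed
  have "G (x + int n) y i = G x y i + D T 0 i" if "T \<le> x + y" "i < l" for x y i
    using const[OF that] D_def[of x y i] by linarith
  then show ?thesis unfolding speeds_from_def by blast
qed

lemma speeds_iterate:
  assumes M: "speeds_from T M" and xy: "T \<le> x + y" "i < l"
  shows "G (x + int m * int n) y i = G x y i + int m * M i"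
proof (induction m)
  case (Suc m)
  have "0 \<le> int m * int n" by simp
  then have "T \<le> x + int m * int n + y" using xy by linarith
  then have "G (x + int m * int n + int n) y i = G (x + int m * int n) y i + M i"
    using M xy(2) unfolding speeds_from_def by blast
  then show ?case using Suc by (simp add: algebra_simps)
qed simp

lemma speeds_nonneg:
  assumes M: "speeds_from T M" and "i < l"
  shows "0 \<le> M i"
proof -
  have "G T 0 i \<le> G (T + int m) 0 i" for m
  proof (induction m)
    case (Suc m)
    then show ?case using mono_x[OF \<open>i < l\<close>, of "T + int m" 0] by (simp add: algebra_simps)
  qed simp
  from this[of n] show ?thesis using M \<open>i < l\<close> by (simp add: speeds_from_def)
qed

text \<open>A faster row of larger index would eventually overtake row \<open>i\<close>;
  \<open>m\<close> periods suffice.\<close>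

lemma speeds_antimono:
  assumes M: "speeds_from T M" and "i \<le> j" "j < l"
  shows "M j \<le> M i"
proof (rule ccontr)
  assume "\<not> M j \<le> M i"
  then have lt: "1 \<le> M j - M i" by simp
  define m where "m = nat (G T 0 i - G T 0 j + 1)"
  have "G T 0 j + int m * M j \<le> G T 0 i + int m * M i"
    using rows_antimono'[OF assms(2,3), of "T + int m * int n" 0]
      speeds_iterate[OF M, of T 0 j m] speeds_iterate[OF M, of T 0 i m] assms(2,3) by simp
  then have "int m * (M j - M i) \<le> G T 0 i - G T 0 j" by (simp add: algebra_simps)
  moreover have "int m * 1 \<le> int m * (M j - M i)" using lt by (intro mult_left_mono) auto
  moreover have "G T 0 i - G T 0 j + 1 \<le> int m" by (simp add: m_def)
  ultimately show False by linarith
qed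

end

subsection \<open>Conservation of the speeds\<close>

text \<open>Used with potentials \<open>f\<close> before and \<open>g\<close> after a hop, to
  telescope costs along a path.\<close>

lemma sum_list_map2_ge:
  fixes g :: "nat \<Rightarrow> int"
  assumes "list_all2 P I J" "config l I" "config l J"
    and "\<And>i j. P i j \<Longrightarrow> i < l \<Longrightarrow> j < l \<Longrightarrow> g j - f i \<le> c i j"
  shows "sum_list (map g J) - sum_list (map f I) \<le> sum_list (map2 c I J)"
  using assms(1-3)
proof (induction rule: list_all2_induct)
  case (Cons i I j J)
  then have "sum_list (map g J) - sum_list (map f I) \<le> sum_list (map2 c I J)"
    by (simp add: config_def)
  moreover have "g j - f i \<le> c i j" using Cons by (intro assms(4)) (auto simp: config_def)
  ultimately show ?case by simp
qed simp

text \<open>The induction removes the largest row \<open>z\<close>, where \<open>M\<close> is at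
  least \<open>M (l - 1)\<close>; the other rows form a configuration below
  \<open>z\<close>.\<close>

lemma sum_list_config_ge:
  fixes M :: "nat \<Rightarrow> int"
  assumes "config l I" and "\<And>i j. i \<le> j \<Longrightarrow> j < l \<Longrightarrow> M j \<le> M i"
  shows "(\<Sum>i<length I. M (l - 1 - i)) \<le> sum_list (map M I)"
  using assms
proof (induction I arbitrary: l rule: rev_induct)
  case (snoc z I)
  have z: "z < l" "config z I" using snoc.prems(1) by (auto simp: config_def sorted_wrt_append)
  have len: "length I \<le> z"
  proof -
    have "card (set I) = length I"
      using z(2) by (intro distinct_card) (auto simp: config_def strict_sorted_iff)
    moreover have "card (set I) \<le> card {..<z}"
      using z(2) by (intro card_mono) (auto simp: config_def)
    ultimately show ?thesis by simp
  qed
  have "(\<Sum>i<length (I @ [z]). M (l - 1 - i)) = M (l - 1) + (\<Sum>i<length I. M (l - 1 - Suc i))"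
    by (simp only: length_append_singleton sum.lessThan_Suc_shift) simp
  also have "\<dots> \<le> M z + (\<Sum>i<length I. M (z - 1 - i))"
    using z(1) len by (intro add_mono sum_mono snoc.prems(2)) auto
  also have "\<dots> \<le> M z + sum_list (map M I)"
    using z snoc.prems(2) by (intro add_left_mono snoc.IH) auto
  finally show ?case by simp
qed simp

section \<open>Closed paths and their costs\<close>

context rows_field
begin

primrec right_path :: "int \<Rightarrow> int \<Rightarrow> nat \<Rightarrow> nat list \<Rightarrow> nat list \<Rightarrow> int \<Rightarrow> bool" where
  "right_path x y 0 I J w \<longleftrightarrow> config l I \<and> I = J \<and> w = 0"
| "right_path x y (Suc p) I J w \<longleftrightarrow> (\<exists>K v. right_path x y p I K v \<and> config l J \<and> list_all2 right_hop K J \<and>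
     w = v + sum_list (map2 (right_cost (G (x + int p) y) (G (x + int p + 1) y)) K J))"

text \<open>The recursion extends the path at its start: \<open>I\<close> sits at
  \<open>(x, y + m)\<close> and \<open>J\<close> at \<open>(x, y)\<close>.\<close>

primrec down_path :: "int \<Rightarrow> int \<Rightarrow> nat \<Rightarrow> nat list \<Rightarrow> nat list \<Rightarrow> int \<Rightarrow> bool" where
  "down_path x y 0 I J w \<longleftrightarrow> config l I \<and> I = J \<and> w = 0"
| "down_path x y (Suc m) I J w \<longleftrightarrow> (\<exists>K v. down_path x y m K J v \<and> config l I \<and> list_all2 down_hop I K \<and>
     w = v + sum_list (map2 (down_cost (G x (y + int m)) (G x (y + int m + 1))) I K))"

lemma right_path_config: "right_path x y p I J w \<Longrightarrow> config l I \<and> config l J \<and> length I = length J"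
  by (induction p arbitrary: J w) (auto dest: list_all2_lengthD)

lemma down_path_config: "down_path x y m I J w \<Longrightarrow> config l I \<and> config l J \<and> length I = length J"
  by (induction m arbitrary: I w) (auto dest: list_all2_lengthD)

lemma right_path_periodic: "right_path x (y + int n) p I J w = right_path (x + int n) y p I J w"
proof (induction p arbitrary: J w)
  case (Suc p)
  have "G (x + int n + int p) y = G (x + int p) (y + int n)"
    "G (x + int n + int p + 1) y = G (x + int p + 1) (y + int n)"
    using periodic[of "x + int p" y] periodic[of "x + int p + 1" y] by (simp_all add: ac_simps)
  then show ?case using Suc.IH by simp
qed simp

text \<open>Going from left to right, \<open>exchange\<close> moves the down step past one right
  step at a time.\<close>

lemma strip:
  assumes "list_all2 down_hop I K" "config l I" "right_path x y p K J w"
  shows "\<exists>K' w'. right_path x (y + 1) p I K' w' \<and> list_all2 down_hop K' J \<and>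
    w' + sum_list (map2 (down_cost (G (x + int p) y) (G (x + int p) (y + 1))) K' J)
      \<le> sum_list (map2 (down_cost (G x y) (G x (y + 1))) I K) + w"
  using assms(3)
proof (induction p arbitrary: J w)
  case 0
  then show ?case using assms(1,2) by auto
next
  case (Suc p)
  let ?dc = "down_cost (G (x + int p) y) (G (x + int p) (y + 1))"
  let ?rc = "right_cost (G (x + int p) y) (G (x + int p + 1) y)"
  obtain L v where L: "right_path x y p K L v" "config l J" "list_all2 right_hop L J"
      "w = v + sum_list (map2 ?rc L J)"
    using Suc.prems by auto
  obtain L' v' where L': "right_path x (y + 1) p I L' v'" "list_all2 down_hop L' L"
      "v' + sum_list (map2 ?dc L' L) \<le> sum_list (map2 (down_cost (G x y) (G x (y + 1))) I K) + v"
    using Suc.IH[OF L(1)] by blast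
  obtain K' where K': "list_all2 right_hop L' K'" "list_all2 down_hop K' J" "config l K'"
      "sum_list (map2 (right_cost (G (x + int p) (y + 1)) (G (x + int p + 1) (y + 1))) L' K')
        + sum_list (map2 (down_cost (G (x + int p + 1) y) (G (x + int p + 1) (y + 1))) K' J)
      \<le> sum_list (map2 ?dc L' L) + sum_list (map2 ?rc L J)"
    using exchange[OF growth L'(2) L(3)] right_path_config[OF L(1)] right_path_config[OF L'(1)] L(2)
    by blast
  have e: "x + int (Suc p) = x + int p + 1" by simp
  have "right_path x (y + 1) (Suc p) I K'
     (v' + sum_list (map2 (right_cost (G (x + int p) (y + 1)) (G (x + int p + 1) (y + 1))) L' K'))"
    using L'(1) K'(1,3) by auto
  moreover have "v' + sum_list (map2 (right_cost (G (x + int p) (y + 1)) (G (x + int p + 1) (y + 1))) L' K')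
      + sum_list (map2 (down_cost (G (x + int p + 1) y) (G (x + int p + 1) (y + 1))) K' J)
      \<le> sum_list (map2 (down_cost (G x y) (G x (y + 1))) I K) + w"
    using K'(4) L'(3) L(4) by linarith
  ultimately show ?case using K'(2) unfolding e by blast
qed

text \<open>Strips are stacked from bottom to top.\<close>

lemma rectangle:
  assumes "down_path x y m I K v" "right_path x y p K J w"
  shows "\<exists>K' v' w'. right_path x (y + int m) p I K' w' \<and> down_path (x + int p) y m K' J v' \<and>
    w' + v' \<le> v + w"
  using assms(1)
proof (induction m arbitrary: I v)
  case 0
  then show ?case using assms(2) right_path_config[OF assms(2)] by (auto intro!: exI[of _ J])
next
  case (Suc m)
  obtain L u where L: "down_path x y m L K u" "config l I" "list_all2 down_hop I L"
      "v = u + sum_list (map2 (down_cost (G x (y + int m)) (G x (y + int m + 1))) I L)"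
    using Suc.prems by auto
  obtain L' u' w' where L': "right_path x (y + int m) p L L' w'" "down_path (x + int p) y m L' J u'"
      "w' + u' \<le> u + w"
    using Suc.IH[OF L(1)] by blast
  obtain K' v' where K': "right_path x (y + int m + 1) p I K' v'" "list_all2 down_hop K' L'"
      "v' + sum_list (map2 (down_cost (G (x + int p) (y + int m)) (G (x + int p) (y + int m + 1))) K' L')
      \<le> sum_list (map2 (down_cost (G x (y + int m)) (G x (y + int m + 1))) I L) + w'"
    using strip[OF L(3,2) L'(1)] by blast
  have e: "y + int (Suc m) = y + int m + 1" by simp
  have "down_path (x + int p) y (Suc m) K' J (u' +
      sum_list (map2 (down_cost (G (x + int p) (y + int m)) (G (x + int p) (y + int m + 1))) K' L'))"
    using L'(2) K'(2) right_path_config[OF K'(1)] by auto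
  moreover have "v' + (u' +
      sum_list (map2 (down_cost (G (x + int p) (y + int m)) (G (x + int p) (y + int m + 1))) K' L')) \<le> v + w"
    using K'(3) L'(3) L(4) by linarith
  ultimately show ?case using K'(1) unfolding e by blast
qed

text \<open>The points \<open>(t, n)\<close> and \<open>(t + n, 0)\<close> coincide on the cylinder, so these paths are closed.\<close>

definition loop :: "int \<Rightarrow> nat \<Rightarrow> int \<Rightarrow> bool" where
  "loop t k w \<longleftrightarrow> (\<exists>I K u v. length I = k \<and> down_path t 0 n I K u \<and> right_path t 0 n K I v \<and> u + v \<le> w)"

text \<open>After \<open>rectangle\<close> the loop runs right at height \<open>n\<close>, then down
  at \<open>t + n\<close>. By periodicity its right part may be placed at height 0 behind the down
  part, which gives the shifted loop.\<close>

lemma loop_advance: "loop t k w \<Longrightarrow> loop (t + int n) k w"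
proof -
  assume "loop t k w"
  then obtain I K u v where I: "length I = k" "down_path t 0 n I K u" "right_path t 0 n K I v" "u + v \<le> w"
    unfolding loop_def by blast
  obtain K' u' v' where K': "right_path t (0 + int n) n I K' v'" "down_path (t + int n) 0 n K' I u'"
      "v' + u' \<le> u + v"
    using rectangle[OF I(2,3)] by blast
  have "right_path (t + int n) 0 n I K' v'" using K'(1) unfolding right_path_periodic .
  moreover have "length K' = k" using right_path_config[OF K'(1)] I(1) by simp
  moreover have "u' + v' \<le> w" using K'(3) I(4) by linarith
  ultimately show "loop (t + int n) k w" unfolding loop_def using K'(2) by blast
qed

lemma loop_advance_mult: "loop t k w \<Longrightarrow> loop (t + int m * int n) k w"
proof (induction m)
  case (Suc m)
  then show ?case using loop_advance[of "t + int m * int n" k w] by (simp add: algebra_simps)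
qed simp

text \<open>Particles rest on the first \<open>k\<close> rows: down steps are free and the costs of
  right steps telescope.\<close>

lemma constant_loop:
  assumes "k \<le> l"
  shows "loop t k (\<Sum>i<k. G (t + int n) 0 i - G t 0 i)"
proof -
  let ?I = "[0..<k]"
  have I: "config l ?I" using assms by (auto simp: config_def)
  have diag: "map2 c ?I ?I = map (\<lambda>i. c i i) ?I" for c :: "nat \<Rightarrow> nat \<Rightarrow> int"
    by (simp add: list_eq_iff_nth_eq)
  have refl: "list_all2 right_hop ?I ?I" "list_all2 down_hop ?I ?I"
    by (auto simp: list_all2_conv_all_nth right_hop_def down_hop_def)
  have dp: "down_path t 0 m ?I ?I 0" for m
  proof (induction m)
    case (Suc m)
    then show ?case using I refl(2)
      by (auto simp: diag down_cost_def intro!: exI[of _ ?I] exI[of _ "0::int"])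
  qed (use I in simp)
  have rp: "right_path t 0 p ?I ?I (\<Sum>i<k. G (t + int p) 0 i - G t 0 i)" for p
  proof (induction p)
    case (Suc p)
    have "(\<Sum>i<k. G (t + int (Suc p)) 0 i - G t 0 i)
      = (\<Sum>i<k. G (t + int p) 0 i - G t 0 i) + (\<Sum>i<k. G (t + int p + 1) 0 i - G (t + int p) 0 i)"
      unfolding sum.distrib[symmetric] by (rule sum.cong) (simp_all add: add_ac)
    also have "(\<Sum>i<k. G (t + int p + 1) 0 i - G (t + int p) 0 i)
      = sum_list (map2 (right_cost (G (t + int p) 0) (G (t + int p + 1) 0)) ?I ?I)"
      by (simp add: diag right_cost_def sum_list_distinct_conv_sum_set atLeast0LessThan)
    finally show ?case using Suc I refl(1) by (auto intro!: exI[of _ ?I])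
  qed (use I in simp)
  show ?thesis unfolding loop_def using dp[of n] rp[of n]
    by (intro exI[of _ ?I] exI[of _ "0::int"] exI) auto
qed

text \<open>Without carries each row is a function of \<open>x\<close> plus a function of
  \<open>y\<close>. This yields a potential bounding the hop costs from below; along a closed path
  it cancels, leaving the growth of the rows occupied at the start.\<close>

lemma free_loop_ge:
  assumes T: "free_from T" "T \<le> t" and loop: "loop t k w"
  obtains I where "config l I" "length I = k"
    "sum_list (map (\<lambda>i. G (t + int n) 0 i - G t 0 i) I) \<le> w"
proof -
  define H where "H x i = G x 0 i - G t 0 i" for x i
  define V where "V y i = G t y i" for y i
  have step: "G (x + 1) (y + 1) i - G x (y + 1) i = G (x + 1) y i - G x y i"
    if "T \<le> x + y" "i < l" for x y i
    using balance[OF that(2), of x y] T(1) that unfolding free_from_def by simp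
  have row: "G (x + 1) (int m) i - G x (int m) i = G (x + 1) 0 i - G x 0 i" if "T \<le> x" "i < l" for x m i
  proof (induction m)
    case (Suc m)
    then show ?case using step[of x "int m" i] that by (simp add: add_ac)
  qed simp
  have split: "G (t + int p) (int m) i = H (t + int p) i + V (int m) i" if "i < l" for p m i
  proof (induction p)
    case 0
    then show ?case by (simp add: H_def V_def)
  next
    case (Suc p)
    have e: "t + int (Suc p) = t + int p + 1" by simp
    show ?case using Suc row[of "t + int p" i m] T(2) that unfolding e by (simp add: H_def)
  qed
  \<comment> \<open>For fixed \<open>i\<close> the left side depends on \<open>p\<close> only and
    the right side on \<open>m\<close> only.\<close>
  have diag: "H (t + int (Suc p)) (Suc i) - H (t + int p) i \<le> V (int m) i - V (int (Suc m)) (Suc i)"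
    if "Suc i < l" for p m i
  proof -
    have e: "t + int (Suc p) = t + int p + 1" "int (Suc m) = int m + 1" by simp_all
    show ?thesis
      using diagonal_le[OF that, of "t + int p" "int m"] split[of "Suc i" "Suc p" "Suc m"]
        split[of i p m] that unfolding e by simp
  qed
  \<comment> \<open>By \<open>diag\<close>, \<open>\<alpha> i\<close> separates the costs of hopping from \<open>i\<close> to \<open>i + 1\<close> and back, so \<open>\<Phi>\<close> is a potential that
    makes hopping at least as expensive as the difference of the row positions.\<close>
  define \<alpha> where "\<alpha> i = Max ((\<lambda>p. H (t + int (Suc p)) (Suc i) - H (t + int p) i) ` {..<n})" for i
  define \<Phi> where "\<Phi> i = sum \<alpha> {..<i}" for i
  have ne: "(\<lambda>p. H (t + int (Suc p)) (Suc i) - H (t + int p) i) ` {..<n} \<noteq> {}" for i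
    using n_pos by auto
  have up: "H (t + int (Suc p)) (Suc i) - H (t + int p) i \<le> \<alpha> i" if "p < n" for p i
    unfolding \<alpha>_def using that by (intro Max_ge) auto
  have low: "\<alpha> i \<le> V (int m) i - V (int (Suc m)) (Suc i)" if "Suc i < l" for m i
    unfolding \<alpha>_def by (rule Max.boundedI) (use ne diag[OF that] in auto)
  have neg: "sum_list (map (\<lambda>i. - \<Phi> i) K) = - sum_list (map \<Phi> K)" for K by (induction K) auto
  have dp: "sum_list (map \<Phi> I) - sum_list (map \<Phi> K) \<le> u" if "down_path t 0 m I K u" for m I K u
    using that
  proof (induction m arbitrary: I u)
    case (Suc m)
    then obtain L v where L: "down_path t 0 m L K v" "config l I" "list_all2 down_hop I L"
      "u = v + sum_list (map2 (down_cost (G t (int m)) (G t (int m + 1))) I L)" by auto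
    have "sum_list (map (\<lambda>i. - \<Phi> i) L) - sum_list (map (\<lambda>i. - \<Phi> i) I)
        \<le> sum_list (map2 (down_cost (G t (int m)) (G t (int m + 1))) I L)"
    proof (rule sum_list_map2_ge[OF L(3,2)])
      show "config l L" using down_path_config[OF L(1)] by simp
      fix i j assume ij: "down_hop i j" "i < l" "j < l"
      show "- \<Phi> j - - \<Phi> i \<le> down_cost (G t (int m)) (G t (int m + 1)) i j"
        using ij low[of j m] by (auto simp: down_hop_def down_cost_def \<Phi>_def V_def add_ac)
    qed
    then show ?case using Suc.IH[OF L(1)] L(4) unfolding neg by simp
  qed simp
  \<comment> \<open>With \<open>H\<close> added to the potential, a resting particle pays exactly
    the difference; for a hop to the next row the difference is at most 0 by
    \<open>up\<close>.\<close>
  have rp: "sum_list (map (\<lambda>i. H (t + int p) i - \<Phi> i) J) - sum_list (map (\<lambda>i. - \<Phi> i) K) \<le> v"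
    if "right_path t 0 p K J v" "p \<le> n" for p J K v
    using that
  proof (induction p arbitrary: J v)
    case 0
    then show ?case by (simp add: H_def)
  next
    case (Suc p)
    then obtain L w where L: "right_path t 0 p K L w" "config l J" "list_all2 right_hop L J"
      "v = w + sum_list (map2 (right_cost (G (t + int p) 0) (G (t + int p + 1) 0)) L J)" by auto
    have e: "t + int (Suc p) = t + int p + 1" by simp
    have "sum_list (map (\<lambda>i. H (t + int (Suc p)) i - \<Phi> i) J) - sum_list (map (\<lambda>i. H (t + int p) i - \<Phi> i) L)
        \<le> sum_list (map2 (right_cost (G (t + int p) 0) (G (t + int p + 1) 0)) L J)"
    proof (rule sum_list_map2_ge[OF L(3) _ L(2)])
      show "config l L" using right_path_config[OF L(1)] by simp
      fix i j assume ij: "right_hop i j" "i < l" "j < l"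
      show "H (t + int (Suc p)) j - \<Phi> j - (H (t + int p) i - \<Phi> i)
          \<le> right_cost (G (t + int p) 0) (G (t + int p + 1) 0) i j"
        using ij up[of p i] Suc.prems(2) unfolding e
        by (auto simp: right_hop_def right_cost_def \<Phi>_def H_def add_ac)
    qed
    then show ?case using Suc.IH[OF L(1)] Suc.prems(2) L(4) by simp
  qed
  obtain I K u v where I: "length I = k" "down_path t 0 n I K u" "right_path t 0 n K I v" "u + v \<le> w"
    using loop unfolding loop_def by blast
  have sub: "sum_list (map (\<lambda>i. H (t + int n) i - \<Phi> i) I)
      = sum_list (map (\<lambda>i. H (t + int n) i) I) - sum_list (map \<Phi> I)"
    by (rule sum_list_subtractf)
  have "sum_list (map (\<lambda>i. H (t + int n) i) I) \<le> w"
    using dp[OF I(2)] rp[OF I(3)] I(4) unfolding neg sub by simp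
  then show thesis
    using that[of I] down_path_config[OF I(2)] I(1) unfolding H_def by blast
qed

text \<open>A constant loop in the far past costs the right side. Advanced to the far future at this
  cost, it bounds the left side.\<close>

lemma speeds_le:
  assumes M: "speeds_from T M"
    and N: "\<And>x y i. x + y \<le> T' \<Longrightarrow> i < l \<Longrightarrow> G (x - int n) y i = G x y i - N i"
    and k: "k \<le> l"
  shows "(\<Sum>i<k. M (l - 1 - i)) \<le> (\<Sum>i<k. N i)"
proof -
  obtain T0 where T0: "free_from T0" using ex_free_from by blast
  define q where "q = nat (\<bar>T\<bar> + \<bar>T0\<bar> + \<bar>T'\<bar> + 1)"
  have "int q * 1 \<le> int q * int n" using n_pos by (intro mult_left_mono) auto
  moreover have "int q = \<bar>T\<bar> + \<bar>T0\<bar> + \<bar>T'\<bar> + 1" by (simp add: q_def)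
  ultimately have q: "T \<le> int q * int n" "T0 \<le> int q * int n" "- (int q * int n) \<le> T'"
    by linarith+
  \<comment> \<open>One period before \<open>- (int q * int n)\<close>, so that \<open>N\<close>
    gives the growth from \<open>t\<close> to \<open>t + int n\<close>; after
    \<open>2 * q + 1\<close> periods the loop is at \<open>int q * int n\<close>.\<close>
  define t where "t = - (int q * int n) - int n"
  have "loop t k (\<Sum>i<k. G (t + int n) 0 i - G t 0 i)" by (rule constant_loop[OF k])
  also have "(\<Sum>i<k. G (t + int n) 0 i - G t 0 i) = (\<Sum>i<k. N i)"
  proof (rule sum.cong)
    fix i assume "i \<in> {..<k}"
    then show "G (t + int n) 0 i - G t 0 i = N i"
      using N[of "t + int n" 0 i] q(3) k by (simp add: t_def)
  qed simp
  finally have "loop (t + int (2 * q + 1) * int n) k (\<Sum>i<k. N i)" by (rule loop_advance_mult)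
  moreover have e: "t + int (2 * q + 1) * int n = int q * int n" by (simp add: t_def algebra_simps)
  ultimately have "loop (int q * int n) k (\<Sum>i<k. N i)" by (simp only: e)
  from free_loop_ge[OF T0 q(2) this] obtain I where I: "config l I" "length I = k"
    "sum_list (map (\<lambda>i. G (int q * int n + int n) 0 i - G (int q * int n) 0 i) I) \<le> (\<Sum>i<k. N i)"
    by blast
  have maps: "map (\<lambda>i. G (int q * int n + int n) 0 i - G (int q * int n) 0 i) I = map M I"
    using M q(1) I(1) unfolding speeds_from_def config_def by auto
  have "(\<Sum>i<length I. M (l - 1 - i)) \<le> sum_list (map M I)"
    using I(1) by (rule sum_list_config_ge) (rule speeds_antimono[OF M])
  then show ?thesis using I(2,3) unfolding maps by simp
qed

text \<open>Past speeds are future speeds of the reversed field. Applying \<open>speeds_le\<close>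
  to both fields equates all partial sums, hence the terms.\<close>

lemma asymptotic_speeds:
  obtains T M where "speeds_from T M"
    "\<And>x y i. x + y \<le> - T \<Longrightarrow> i < l \<Longrightarrow> G (x - int n) y i = G x y i - M (l - 1 - i)"
proof -
  interpret D: rows_field n l "\<lambda>x y i. - G (- x) (- y) (l - 1 - i)"
    "\<lambda>x y i. d (- x - 1) (- y - 1) (l - i)" by (rule dual)
  obtain T1 M where M: "speeds_from T1 M" using ex_free_from ex_speeds_from by blast
  obtain T2 N where N: "D.speeds_from T2 N" using D.ex_free_from D.ex_speeds_from by blast
  have past: "G (x - int n) y i = G x y i - N (l - 1 - i)" if "x + y \<le> - T2" "i < l" for x y i
  proof -
    have "l - 1 - (l - 1 - i) = i" "l - 1 - i < l" "T2 \<le> - x + - y" using that by auto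
    then show ?thesis using N[unfolded D.speeds_from_def, rule_format, of "- x" "- y" "l - 1 - i"] by simp
  qed
  have dpast: "- G (- (x - int n)) (- y) (l - 1 - i) = - G (- x) (- y) (l - 1 - i) - M (l - 1 - i)"
    if "x + y \<le> - T1" "i < l" for x y i
    using M[unfolded speeds_from_def, rule_format, of "- x" "- y" "l - 1 - i"] that by simp
  have sums: "(\<Sum>i<k. M (l - 1 - i)) = (\<Sum>i<k. N (l - 1 - i))" if "k \<le> l" for k
    using speeds_le[OF M past that] D.speeds_le[OF N dpast that] by (rule antisym)
  have eq: "M (l - 1 - i) = N (l - 1 - i)" if "i < l" for i
    using sums[of i] sums[of "Suc i"] that by simp
  show thesis
  proof (rule that[of "max T1 T2" M])
    show "speeds_from (max T1 T2) M" using M unfolding speeds_from_def by auto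
    show "G (x - int n) y i = G x y i - M (l - 1 - i)" if "x + y \<le> - max T1 T2" "i < l" for x y i
      using past[of x y i] eq[OF that(2)] that by simp
  qed
qed

end

section \<open>From the speeds to the partition\<close>

lemma decreasing_nonneg_list:
  fixes xs :: "int list"
  assumes "sorted_wrt (\<ge>) xs" "\<forall>x\<in>set xs. 0 \<le> x"
  shows "xs = filter (\<lambda>x. 0 < x) xs @ replicate (length xs - length (filter (\<lambda>x. 0 < x) xs)) 0"
  using assms
proof (induction xs)
  case (Cons x xs)
  show ?case
  proof (cases "0 < x")
    case True
    then show ?thesis using Cons by simp
  next
    case False
    then have x: "x = 0" using Cons.prems(2) by simp
    have "y = 0" if "y \<in> set xs" for y
      using Cons.prems that x by (intro antisym) auto
    then have "replicate (length (x # xs)) 0 = x # xs" "filter (\<lambda>x. 0 < x) (x # xs) = []"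
      using x by (auto simp: replicate_length_same filter_empty_conv)
    then show ?thesis by simp
  qed
qed simp

theorem theorem1p3:
  fixes n l :: nat and F :: "(int \<times> int) set \<Rightarrow> int list"
  assumes "n \<ge> 1"
    and "fomin_field n l F"
  shows "\<exists>\<mu> :: int list. is_partition \<mu> \<and> length \<mu> \<le> l \<and>
    (\<exists>T :: int. T > 0 \<and> (\<forall>t \<ge> T. \<forall>i \<in> {0..int n}.
       F (cyl_point n (t + int n) i) =
         map2 (+) (F (cyl_point n t i)) (\<mu> @ replicate (l - length \<mu>) 0) \<and>
       F (cyl_point n (- t - int n) i) =
         map2 (-) (F (cyl_point n (- t) i)) (replicate (l - length \<mu>) 0 @ rev \<mu>)))"
proof -
  define P where "P x y = F (cyl_point n x y)" for x y
  have field: "P x y \<in> signatures l" "P x y \<preceq> P (x + 1) y" "P x y \<preceq> P x (y + 1)"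
    "P (x + 1) (y + 1) = fomin_growth (P x y) (P (x + 1) y) (P x (y + 1))" for x y
    using assms(2) cyl_point_in_cylinder[of n x y]
    unfolding fomin_field_def P_def by (metis translate_cyl_point add_0_right)+
  have len: "length (P x y) = l" for x y using field(1)[of x y] by (simp add: signatures_def)
  have "\<exists>d. growth_rows l ((!) (P x y)) ((!) (P (x + 1) y)) ((!) (P x (y + 1))) ((!) (P (x + 1) (y + 1))) d"
    for x y
    using fomin_growth_rows[OF field(1) field(1) field(1) field(2) field(3)] unfolding field(4)[symmetric] .
  then obtain d where
    d: "\<And>x y. growth_rows l ((!) (P x y)) ((!) (P (x + 1) y)) ((!) (P x (y + 1))) ((!) (P (x + 1) (y + 1))) (d x y)"
    by metis
  interpret rows_field n l "\<lambda>x y i. P x y ! i" d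
  proof
    show "n > 0" using assms(1) by simp
    show "(!) (P (x + int n) y) = (!) (P x (y + int n))" for x y
    proof -
      have "((x, y + int n), (x + int n, y)) \<in> cyl_rel n"
        unfolding cyl_rel_def by (auto intro: exI[of _ 1])
      then have "cyl_point n x (y + int n) = cyl_point n (x + int n) y"
        unfolding cyl_point_def by (rule equiv_class_eq[OF equiv_cyl_rel])
      then show ?thesis by (simp add: P_def)
    qed
    show "P x y ! i \<le> P (x + 1) y ! i" if "i < l" for x y i
      using field(2)[of x y] that len by (auto simp: interlaces_def)
    show "P x y ! Suc i \<le> P x y ! i" if "Suc i < l" for x y i
      using field(1)[of x y] that by (auto simp: signatures_def sorted_wrt_iff_nth_less)
  qed (rule d)
  obtain T M where M: "speeds_from T M"
    and past: "\<And>x y i. x + y \<le> - T \<Longrightarrow> i < l \<Longrightarrow> P (x - int n) y ! i = P x y ! i - M (l - 1 - i)"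
    using asymptotic_speeds by blast
  define xs where "xs = map M [0..<l]"
  define \<mu> where "\<mu> = filter (\<lambda>x. 0 < x) xs"
  have xs: "sorted_wrt (\<ge>) xs" "\<forall>x\<in>set xs. 0 \<le> x" "length xs = l"
    using speeds_antimono[OF M] speeds_nonneg[OF M] by (auto simp: xs_def sorted_wrt_iff_nth_less)
  have pad: "\<mu> @ replicate (l - length \<mu>) 0 = xs"
    using decreasing_nonneg_list[OF xs(1,2)] xs(3) by (simp add: \<mu>_def)
  have rpad: "replicate (l - length \<mu>) 0 @ rev \<mu> = rev xs"
    unfolding pad[symmetric] by simp
  have "is_partition \<mu>" using xs(1) by (auto simp: is_partition_def \<mu>_def sorted_wrt_filter)
  moreover have "length \<mu> \<le> l" using xs(3) unfolding \<mu>_def by (metis length_filter_le)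
  \<comment> \<open>The past formula needs \<open>- t + i \<le> - T\<close> up to
    \<open>i = int n\<close>, whence the summand \<open>int n\<close> in the bound.\<close>
  moreover have "F (cyl_point n (t + int n) i) = map2 (+) (F (cyl_point n t i)) xs \<and>
      F (cyl_point n (- t - int n) i) = map2 (-) (F (cyl_point n (- t) i)) (rev xs)"
    if t: "\<bar>T\<bar> + int n + 1 \<le> t" and i: "i \<in> {0..int n}" for t i
  proof
    have "P (t + int n) i = map2 (+) (P t i) xs"
      using M t i by (intro nth_equalityI) (auto simp: len xs_def speeds_from_def)
    then show "F (cyl_point n (t + int n) i) = map2 (+) (F (cyl_point n t i)) xs"
      by (simp add: P_def)
    have "P (- t - int n) i = map2 (-) (P (- t) i) (rev xs)"
      using past[of "- t" i] t i by (intro nth_equalityI) (auto simp: len xs_def rev_nth)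
    then show "F (cyl_point n (- t - int n) i) = map2 (-) (F (cyl_point n (- t) i)) (rev xs)"
      by (simp add: P_def)
  qed
  ultimately show ?thesis unfolding pad rpad[symmetric]
    by (intro exI[of _ \<mu>] conjI exI[of _ "\<bar>T\<bar> + int n + 1"]) (auto simp: pad rpad)
qed

end
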